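(* Let $G$ be a finite simple undirected graph and let $H$ be an induced subgraph of $G$. Then $$\operatorname{ML-degree}(G)\ \ge\ \operatorname{ML-degree}(H).$$
   Context: Let $G=(V,E)$ be a finite simple undirected graph with $n$ vertices $V=[n]=\{1,\dots,n\}$. Let $S^2(\mathbb{C}^n)$ be the space of complex symmetric $n\times n$ matrices. $L_G\subset S^2(\mathbb{C}^n)$ is the linear space of symmetric matrices $M$ with $M_{ij}=0$ whenever $i\neq j$ and $\{i,j\}\notin E$. $L_G^{-1}$ is the closure in $S^2(\mathbb{C}^n)$ of the set of inverses of invertible matrices in $L_G$. $L_G^{\perp}$ is the orthogonal complement of $L_G$ with respect to the bilinear trace form, i.e. the symmetric matrices that vanish on the diagonal and at all positions $(i,j)$ with $\{i,j\}\in E$. The ML-degree of $G$ is the number of points of $(S+L_G^{\perp})\cap L_G^{-1}$ for a generic symmetric matrix $S\in S^2(\mathbb{C}^n)$ (this number does not depend on the generic choice of $S$). *)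

theory Defs
  imports "HOL-Analysis.Analysis" "Graph_Theory.Pair_Digraph" "Graph_Theory.Digraph_Component"
begin

text \<open>
  A finite simple undirected graph is a \<^locale>\<open>pair_graph\<close>: finite, loop-free, with a symmetric
  set of arcs, so that the edge \<open>{i, j}\<close> is represented by the arcs \<open>(i, j)\<close> and \<open>(j, i)\<close>.

  Matrices are indexed by the finite vertex set \<open>V\<close> itself (an arbitrary finite set instead of
  \<open>{1, \<dots>, n}\<close>), so that an induced subgraph needs no relabelling. They are functions
  that are extended by \<open>0\<close> outside \<open>V \<times> V\<close>, which makes the representation unique.
\<close>

definition sym_matrices :: "'a set \<Rightarrow> ('a \<Rightarrow> 'a \<Rightarrow> complex) set" where
  "sym_matrices V = {M. (\<forall>i j. M i j = M j i) \<and> (\<forall>i j. (i, j) \<notin> V \<times> V \<longrightarrow> M i j = 0)}"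

definition mat_prod ::
    "'a set \<Rightarrow> ('a \<Rightarrow> 'a \<Rightarrow> complex) \<Rightarrow> ('a \<Rightarrow> 'a \<Rightarrow> complex) \<Rightarrow> 'a \<Rightarrow> 'a \<Rightarrow> complex" where
  "mat_prod V A B = (\<lambda>i j. \<Sum>k\<in>V. A i k * B k j)"

definition mat_id :: "'a set \<Rightarrow> 'a \<Rightarrow> 'a \<Rightarrow> complex" where
  "mat_id V = (\<lambda>i j. if i = j \<and> i \<in> V then 1 else 0)"

definition mat_trace :: "'a set \<Rightarrow> ('a \<Rightarrow> 'a \<Rightarrow> complex) \<Rightarrow> complex" where
  "mat_trace V A = (\<Sum>i\<in>V. A i i)"

definition mat_inverses ::
    "'a set \<Rightarrow> ('a \<Rightarrow> 'a \<Rightarrow> complex) \<Rightarrow> ('a \<Rightarrow> 'a \<Rightarrow> complex) \<Rightarrow> bool" where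
  "mat_inverses V A B \<longleftrightarrow> mat_prod V A B = mat_id V \<and> mat_prod V B A = mat_id V"

text \<open>Polynomial functions in the matrix entries, and the Zariski topology they define on
  \<^term>\<open>sym_matrices V\<close>.\<close>

inductive_set poly_functions :: "'a set \<Rightarrow> (('a \<Rightarrow> 'a \<Rightarrow> complex) \<Rightarrow> complex) set"
  for V :: "'a set" where
  const: "(\<lambda>M. c) \<in> poly_functions V"
| entry: "i \<in> V \<Longrightarrow> j \<in> V \<Longrightarrow> (\<lambda>M. M i j) \<in> poly_functions V"
| add: "p \<in> poly_functions V \<Longrightarrow> q \<in> poly_functions V \<Longrightarrow> (\<lambda>M. p M + q M) \<in> poly_functions V"
| mult: "p \<in> poly_functions V \<Longrightarrow> q \<in> poly_functions V \<Longrightarrow> (\<lambda>M. p M * q M) \<in> poly_functions V"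

definition zariski_closure ::
    "'a set \<Rightarrow> ('a \<Rightarrow> 'a \<Rightarrow> complex) set \<Rightarrow> ('a \<Rightarrow> 'a \<Rightarrow> complex) set" where
  "zariski_closure V X =
     {M \<in> sym_matrices V. \<forall>p\<in>poly_functions V. (\<forall>N\<in>X. p N = 0) \<longrightarrow> p M = 0}"

text \<open>A property holds for generic \<open>S\<close> if it holds on a nonempty Zariski-open set; the nonempty
  basic open sets \<open>{S. p S \<noteq> 0}\<close> suffice.\<close>

definition generically :: "'a set \<Rightarrow> (('a \<Rightarrow> 'a \<Rightarrow> complex) \<Rightarrow> bool) \<Rightarrow> bool" where
  "generically V P \<longleftrightarrow>
     (\<exists>p\<in>poly_functions V. (\<exists>S\<in>sym_matrices V. p S \<noteq> 0) \<and>
        (\<forall>S\<in>sym_matrices V. p S \<noteq> 0 \<longrightarrow> P S))"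

definition graph_space :: "'a pair_pre_digraph \<Rightarrow> ('a \<Rightarrow> 'a \<Rightarrow> complex) set" where
  "graph_space G = {M \<in> sym_matrices (pverts G). \<forall>i j. i \<noteq> j \<and> (i, j) \<notin> parcs G \<longrightarrow> M i j = 0}"

definition graph_space_inv :: "'a pair_pre_digraph \<Rightarrow> ('a \<Rightarrow> 'a \<Rightarrow> complex) set" where
  "graph_space_inv G = zariski_closure (pverts G)
     {N \<in> sym_matrices (pverts G). \<exists>M\<in>graph_space G. mat_inverses (pverts G) M N}"

definition graph_space_perp :: "'a pair_pre_digraph \<Rightarrow> ('a \<Rightarrow> 'a \<Rightarrow> complex) set" where
  "graph_space_perp G = {N \<in> sym_matrices (pverts G).
     \<forall>M\<in>graph_space G. mat_trace (pverts G) (mat_prod (pverts G) M N) = 0}"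

definition ml_fibre ::
    "'a pair_pre_digraph \<Rightarrow> ('a \<Rightarrow> 'a \<Rightarrow> complex) \<Rightarrow> ('a \<Rightarrow> 'a \<Rightarrow> complex) set" where
  "ml_fibre G S = {\<lambda>i j. S i j + N i j | N. N \<in> graph_space_perp G} \<inter> graph_space_inv G"

definition ml_degree :: "'a pair_pre_digraph \<Rightarrow> nat" where
  "ml_degree G =
     (THE d. generically (pverts G) (\<lambda>S. finite (ml_fibre G S) \<and> card (ml_fibre G S) = d))"

end

theory Submission
  imports Defs "Jordan_Normal_Form.Determinant"
begin

text \<open>The obstacle is that \<open>X\<close> is known only through the polynomials vanishing on
  the inverses. It may contain singular matrices, where inversion gives no chart, and all
  information about them comes from identities that pass from the invertible part to the closure. An
  algebraic relation serves twice: its top coefficient controls where fibre points can escape to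
  infinity, its bottom coefficient where a given polynomial can vanish on a fibre. The latter,
  applied to the determinant and to the Jacobian, removes the singular and the ramified points. The
  identity matrix is the base point throughout: it lies in every space L_G, and inversion has
  derivative -1 there, so determinant and Jacobian are both nonzero. The ML-degree is a definite
  description, so generic constancy has to precede any comparison. The fibre of G that receives the
  points of H is special because all its prescribed entries between H and the other vertices are 0.
  It might be infinite or contain singular points, so only the selected points are followed, which
  yields an inequality.\<close>

text \<open>
  Let \<open>X = L\<^sub>G\<^sup>-\<^sup>1\<close>, with the projection \<open>\<pi>\<close> onto the entries on the diagonal and on the edges, so
  that the ML-degree counts the points of a generic fibre of \<open>\<pi>\<close> on \<open>X\<close>. A dimension count shows that
  every polynomial function on \<open>X\<close> is algebraic over these entries. Hence over the complement of
  a suitable hypersurface the fibres are locally bounded and consist of invertible matrices at which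
  the Jacobian of \<open>\<pi>\<close> does not vanish, so \<open>\<pi>\<close> is a finite covering there. Two points of this complement lie
  on a complex line that meets the hypersurface in finitely many points, so the number of sheets is constant.

  If \<open>H\<close> is induced on \<open>W\<close>, then \<open>N \<mapsto> N \<oplus> 1\<close> maps a generic fibre of \<open>H\<close> injectively into a (special) fibre
  of \<open>G\<close>. The Jacobian of \<open>G\<close> at \<open>N \<oplus> 1\<close> is a polynomial in \<open>N\<close> that does not vanish at \<open>N = 1\<close>, so for a
  generic fibre of \<open>H\<close> the images are points at which \<open>\<pi>\<close> is a local homeomorphism. They persist in all
  nearby fibres of \<open>G\<close>, in particular in generic ones.
\<close>

section \<open>Polynomial functions\<close>

text \<open>A counterpart of \<open>poly_functions\<close> for arbitrary index sets. The entries of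
  a symmetric matrix are tied by symmetry, so the geometry is carried out in independent
  coordinates.\<close>

inductive_set polyfun :: "'i set \<Rightarrow> (('i \<Rightarrow> complex) \<Rightarrow> complex) set" for I :: "'i set" where
  const: "(\<lambda>x. c) \<in> polyfun I"
| coord: "i \<in> I \<Longrightarrow> (\<lambda>x. x i) \<in> polyfun I"
| add: "p \<in> polyfun I \<Longrightarrow> q \<in> polyfun I \<Longrightarrow> (\<lambda>x. p x + q x) \<in> polyfun I"
| mult: "p \<in> polyfun I \<Longrightarrow> q \<in> polyfun I \<Longrightarrow> (\<lambda>x. p x * q x) \<in> polyfun I"

lemma polyfun_uminus: "p \<in> polyfun I \<Longrightarrow> (\<lambda>x. - p x) \<in> polyfun I"
  using polyfun.mult[OF polyfun.const[of "-1"]] by fastforce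

lemma polyfun_sum: "(\<And>a. a \<in> A \<Longrightarrow> f a \<in> polyfun I) \<Longrightarrow> (\<lambda>x. \<Sum>a\<in>A. f a x) \<in> polyfun I"
  by (induction A rule: infinite_finite_induct) (auto intro: polyfun.intros)

lemma polyfun_prod: "(\<And>a. a \<in> A \<Longrightarrow> f a \<in> polyfun I) \<Longrightarrow> (\<lambda>x. \<Prod>a\<in>A. f a x) \<in> polyfun I"
  by (induction A rule: infinite_finite_induct) (auto intro: polyfun.intros)

lemma polyfun_power: "p \<in> polyfun I \<Longrightarrow> (\<lambda>x. p x ^ n) \<in> polyfun I"
  by (induction n) (auto intro: polyfun.intros)

lemma polyfun_comp:
  assumes "p \<in> polyfun I" "\<And>i. i \<in> I \<Longrightarrow> (\<lambda>x. f x i) \<in> polyfun J"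
  shows "(\<lambda>x. p (f x)) \<in> polyfun J"
  using assms(1) by induction (auto intro: polyfun.intros assms(2))

lemma polyfun_mono: "p \<in> polyfun I \<Longrightarrow> I \<subseteq> J \<Longrightarrow> p \<in> polyfun J"
  using polyfun_comp[of p I "\<lambda>x. x" J] by (auto intro: polyfun.intros)

lemma polyfun_cong: "p \<in> polyfun I \<Longrightarrow> (\<And>i. i \<in> I \<Longrightarrow> x i = y i) \<Longrightarrow> p x = p y"
  by (induction rule: polyfun.induct) auto

lemma poly_functions_comp_polyfun:
  assumes "p \<in> poly_functions V" "\<And>i j. i \<in> V \<Longrightarrow> j \<in> V \<Longrightarrow> (\<lambda>x. f x i j) \<in> polyfun J"
  shows "(\<lambda>x. p (f x)) \<in> polyfun J"
  using assms(1) by induction (auto intro: polyfun.intros assms(2))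

lemma polyfun_comp_poly_functions:
  assumes "p \<in> polyfun I" "\<And>i. i \<in> I \<Longrightarrow> (\<lambda>M. f M i) \<in> poly_functions V"
  shows "(\<lambda>M. p (f M)) \<in> poly_functions V"
  using assms(1) by induction (auto intro: poly_functions.intros assms(2))

lemma continuous_on_polyfun: "p \<in> polyfun I \<Longrightarrow> continuous_on S p"
proof (induction rule: polyfun.induct)
  case (coord i)
  show ?case
    by (rule continuous_on_subset[OF continuous_on_product_coordinates]) simp
qed (auto intro: continuous_intros)

text \<open>Restriction to complex lines reduces questions in several variables to polynomials in
  one variable, which have finitely many zeros unless they vanish identically.\<close>

definition line :: "('i \<Rightarrow> complex) \<Rightarrow> ('i \<Rightarrow> complex) \<Rightarrow> complex \<Rightarrow> 'i \<Rightarrow> complex" where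
  "line x y z = (\<lambda>i. x i + z * (y i - x i))"

lemma line_0 [simp]: "line x y 0 = x" and line_1 [simp]: "line x y 1 = y"
  by (auto simp: line_def)

lemma polyfun_line: "p \<in> polyfun I \<Longrightarrow> \<exists>q. \<forall>z. poly q z = p (line x y z)"
proof (induction rule: polyfun.induct)
  case (const c)
  show ?case by (rule exI[of _ "[:c:]"]) simp
next
  case (coord i)
  show ?case by (rule exI[of _ "[:x i, y i - x i:]"]) (simp add: line_def)
next
  case (add p q)
  then show ?case by (metis poly_add)
next
  case (mult p q)
  then show ?case by (metis poly_mult)
qed

lemma finite_zeros_on_line:
  assumes "p \<in> polyfun I" "p (line x y w) \<noteq> 0"
  shows "finite {z. p (line x y z) = 0}"
proof -
  obtain q where q: "\<forall>z. poly q z = p (line x y z)"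
    using polyfun_line[OF assms(1)] by blast
  then have "q \<noteq> 0" using assms(2) by (metis poly_0)
  then show ?thesis using poly_roots_finite[of q] q by simp
qed

text \<open>On the line through x and y each polynomial has finitely many zeros, p because of the
  parameter 0 and q because of the parameter 1, while every disc around 0 is infinite. With
  \<open>K\<close> empty this says that two nonempty basic open sets meet.\<close>

lemma polyfun_nonzero_near:
  assumes "p \<in> polyfun I" "p x \<noteq> 0" "q \<in> polyfun J" "q y \<noteq> 0" "finite K" "\<epsilon> > 0"
  obtains z where "p (line x y z) \<noteq> 0" "q (line x y z) \<noteq> 0" "\<And>k. k \<in> K \<Longrightarrow> dist (line x y z k) (x k) < \<epsilon>"
proof -
  let ?B = "{z. p (line x y z) = 0} \<union> {z. q (line x y z) = 0}"
  have "finite ?B"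
    using finite_zeros_on_line[OF assms(1), of x y 0] finite_zeros_on_line[OF assms(3), of x y 1] assms by auto
  \<comment> \<open>\<open>L\<close> bounds the speed of each coordinate in \<open>K\<close> along
    the line, so parameters below \<open>\<epsilon> / L\<close> stay within
    \<open>\<epsilon>\<close>. The summand 1 keeps it positive if x and y agree on
    \<open>K\<close>.\<close>
  define L where "L = 1 + (\<Sum>k\<in>K. norm (y k - x k))"
  have L: "L > 0" unfolding L_def by (simp add: add_pos_nonneg sum_nonneg)
  have "infinite (ball (0::complex) (\<epsilon> / L))"
    using L assms(6) islimpt_eq_infinite_ball[of "0::complex" UNIV] by (simp add: islimpt_UNIV)
  then obtain z where z: "z \<in> ball 0 (\<epsilon> / L)" "z \<notin> ?B"
    using \<open>finite ?B\<close> by (meson finite_subset subsetI)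
  have "dist (line x y z k) (x k) < \<epsilon>" if "k \<in> K" for k
  proof -
    have "norm (y k - x k) \<le> (\<Sum>k\<in>K. norm (y k - x k))"
      by (rule member_le_sum) (auto simp: that assms(5))
    then have "norm (y k - x k) \<le> L" unfolding L_def by simp
    then have "norm z * norm (y k - x k) \<le> norm z * L" by (simp add: mult_left_mono)
    also have "\<dots> < \<epsilon>" using z(1) L by (simp add: field_simps)
    finally show ?thesis by (simp add: line_def dist_norm norm_mult)
  qed
  then show thesis using that z(2) by blast
qed

text \<open>Total functions that are 0 off I, so that for \<open>I \<subseteq> J\<close> one affine
  space is literally a linear subspace of the other.\<close>

definition cspace :: "'i set \<Rightarrow> ('i \<Rightarrow> complex) set" where
  "cspace I = {x. \<forall>i. i \<notin> I \<longrightarrow> x i = 0}"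

lemma cspaceD: "x \<in> cspace I \<Longrightarrow> i \<notin> I \<Longrightarrow> x i = 0"
  by (simp add: cspace_def)

lemma cspace_mono: "I \<subseteq> J \<Longrightarrow> cspace I \<subseteq> cspace J"
  by (auto simp: cspace_def)

lemma line_in_cspace: "x \<in> cspace I \<Longrightarrow> y \<in> cspace I \<Longrightarrow> line x y z \<in> cspace I"
  by (simp add: cspace_def line_def)

lemma cspace_eqI: "x \<in> cspace I \<Longrightarrow> y \<in> cspace I \<Longrightarrow> (\<And>i. i \<in> I \<Longrightarrow> x i = y i) \<Longrightarrow> x = y"
  by (metis cspaceD ext)

text \<open>Gaussian elimination, by induction on the equations: a nonzero coefficient at
  \<open>b0\<close> removes one unknown together with one equation.\<close>

lemma underdetermined_system:
  fixes M :: "'b \<Rightarrow> 'c \<Rightarrow> complex"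
  assumes "finite C" "finite B" "card C < card B"
  obtains u where "\<exists>b\<in>B. u b \<noteq> 0" "\<And>c. c \<in> C \<Longrightarrow> (\<Sum>b\<in>B. u b * M b c) = 0"
proof -
  have "\<exists>u. (\<exists>b\<in>B. u b \<noteq> 0) \<and> (\<forall>c\<in>C. (\<Sum>b\<in>B. u b * M b c) = 0)"
    using assms
  proof (induction C arbitrary: B M rule: finite_induct)
    case empty
    then have "B \<noteq> {}" by auto
    then show ?case by (intro exI[of _ "\<lambda>_. 1"]) auto
  next
    case (insert c0 C)
    show ?case
    proof (cases "\<forall>b\<in>B. M b c0 = 0")
      case True
      then show ?thesis using insert.IH[of B M] insert by auto
    next
      case False
      then obtain b0 where b0: "b0 \<in> B" "M b0 c0 \<noteq> 0" by blast
      define B' where "B' = B - {b0}"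
      define M' where "M' b c = M b c - M b c0 / M b0 c0 * M b0 c" for b c
      have "card C < card B'" "finite B'"
        using insert b0 by (auto simp: B'_def)
      then obtain v where v: "\<exists>b\<in>B'. v b \<noteq> 0" "\<forall>c\<in>C. (\<Sum>b\<in>B'. v b * M' b c) = 0"
        using insert.IH[of B' M'] by blast
      \<comment> \<open>The value that equation \<open>c0\<close> forces on the eliminated
        unknown.\<close>
      define w where "w = - (\<Sum>b\<in>B'. v b * M b c0) / M b0 c0"
      define u where "u b = (if b = b0 then w else v b)" for b
      have split: "(\<Sum>b\<in>B. u b * M b c) = w * M b0 c + (\<Sum>b\<in>B'. v b * M b c)" for c
      proof -
        have "(\<Sum>b\<in>B. u b * M b c) = u b0 * M b0 c + (\<Sum>b\<in>B'. u b * M b c)"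
          unfolding B'_def using insert b0 by (simp add: sum.remove)
        also have "(\<Sum>b\<in>B'. u b * M b c) = (\<Sum>b\<in>B'. v b * M b c)"
          by (rule sum.cong) (auto simp: u_def B'_def)
        finally show ?thesis by (simp add: u_def)
      qed
      have "(\<Sum>b\<in>B. u b * M b c0) = 0"
        using split b0 by (simp add: w_def)
      moreover have "(\<Sum>b\<in>B. u b * M b c) = 0" if "c \<in> C" for c
      proof -
        have "(\<Sum>b\<in>B'. v b * M' b c) = (\<Sum>b\<in>B'. v b * M b c) - (\<Sum>b\<in>B'. v b * M b c0) / M b0 c0 * M b0 c"
          unfolding M'_def by (simp add: algebra_simps sum_subtractf sum_distrib_left sum_divide_distrib)
        then show ?thesis using split v(2) that by (simp add: w_def)
      qed
      moreover have "\<exists>b\<in>B. u b \<noteq> 0" using v(1) by (auto simp: u_def B'_def)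
      ultimately show ?thesis by auto
    qed
  qed
  then show thesis using that by blast
qed

section \<open>Monomials and polynomials of bounded degree\<close>

definition monom_fun :: "'i set \<Rightarrow> ('i \<Rightarrow> nat) \<Rightarrow> ('i \<Rightarrow> complex) \<Rightarrow> complex" where
  "monom_fun I \<alpha> x = (\<Prod>i\<in>I. x i ^ \<alpha> i)"

abbreviation expos :: "'i set \<Rightarrow> nat \<Rightarrow> ('i \<Rightarrow> nat) set" where
  "expos I n \<equiv> PiE I (\<lambda>_. {..n})"

lemma monom_fun_polyfun: "monom_fun I \<alpha> \<in> polyfun I"
  unfolding monom_fun_def[abs_def] by (intro polyfun_prod polyfun_power polyfun.coord)

text \<open>For fixed values of the other coordinates the sum is a polynomial in the coordinate i
  that vanishes identically, so each of its coefficients does. These are combinations of monomials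
  in fewer variables.\<close>

lemma monom_fun_independent:
  assumes "finite I" "\<And>x. x \<in> cspace I \<Longrightarrow> (\<Sum>\<alpha>\<in>expos I n. u \<alpha> * monom_fun I \<alpha> x) = 0" "\<alpha> \<in> expos I n"
  shows "u \<alpha> = 0"
  using assms
proof (induction I arbitrary: u \<alpha> rule: finite_induct)
  case empty
  from empty.prems(1)[of "\<lambda>_. 0"] empty.prems(2) show ?case by (simp add: monom_fun_def cspace_def)
next
  case (insert i I)
  \<comment> \<open>\<open>f\<close> joins an exponent of i to an exponent vector on I; it is
    injective because vectors in \<open>expos I n\<close> take a default value at i.\<close>
  define f where "f = (\<lambda>(k::nat, \<beta>::'a \<Rightarrow> nat). \<beta>(i := k))"
  have inj: "inj_on f ({..n} \<times> expos I n)"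
  proof (rule inj_onI, clarify)
    fix k \<beta> k' \<beta>' assume a: "\<beta> \<in> expos I n" "\<beta>' \<in> expos I n" "f (k, \<beta>) = f (k', \<beta>')"
    have "k = k'" using fun_cong[OF a(3), of i] by (simp add: f_def)
    moreover have "\<beta> = \<beta>'"
    proof
      fix x
      show "\<beta> x = \<beta>' x"
      proof (cases "x = i")
        case True
        then show ?thesis using PiE_arb[OF a(1)] PiE_arb[OF a(2)] insert.hyps(2) by metis
      next
        case False
        then show ?thesis using fun_cong[OF a(3), of x] by (simp add: f_def)
      qed
    qed
    ultimately show "k = k' \<and> \<beta> = \<beta>'" by auto
  qed
  have im: "expos (insert i I) n = f ` ({..n} \<times> expos I n)"
    unfolding PiE_insert_eq f_def by (simp add: image_def)
  have mon: "monom_fun (insert i I) (f (k, \<beta>)) (x(i := t)) = t ^ k * monom_fun I \<beta> x" for k \<beta> x t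
  proof -
    have "(\<Prod>j\<in>I. (x(i := t)) j ^ (\<beta>(i := k)) j) = (\<Prod>j\<in>I. x j ^ \<beta> j)"
      by (rule prod.cong) (use insert.hyps in auto)
    then show ?thesis unfolding monom_fun_def f_def using insert.hyps by simp
  qed
  have "(\<Sum>\<beta>\<in>expos I n. u (f (k, \<beta>)) * monom_fun I \<beta> x) = 0" if x: "x \<in> cspace I" and k: "k \<le> n" for x k
  proof -
    have "(\<Sum>k\<le>n. (\<Sum>\<beta>\<in>expos I n. u (f (k, \<beta>)) * monom_fun I \<beta> x) * t ^ k) = 0" for t
    proof -
      have "x(i := t) \<in> cspace (insert i I)" using x by (auto simp: cspace_def)
      then have "0 = (\<Sum>\<alpha>\<in>f ` ({..n} \<times> expos I n). u \<alpha> * monom_fun (insert i I) \<alpha> (x(i := t)))"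
        using insert.prems(1) im by simp
      also have "\<dots> = (\<Sum>(k,\<beta>)\<in>{..n} \<times> expos I n. u (f (k, \<beta>)) * (t ^ k * monom_fun I \<beta> x))"
        by (subst sum.reindex[OF inj]) (auto simp: mon intro!: sum.cong)
      also have "\<dots> = (\<Sum>k\<le>n. \<Sum>\<beta>\<in>expos I n. u (f (k, \<beta>)) * (t ^ k * monom_fun I \<beta> x))"
        by (simp add: sum.cartesian_product)
      finally show ?thesis by (simp add: sum_distrib_right sum_distrib_left mult_ac)
    qed
    then show ?thesis using k polyfun_eq_0[where n = n and c="\<lambda>k. \<Sum>\<beta>\<in>expos I n. u (f (k, \<beta>)) * monom_fun I \<beta> x"] by blast
  qed
  then have "u (f (k, \<beta>)) = 0" if "\<beta> \<in> expos I n" "k \<le> n" for k \<beta>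
    using insert.IH[of "\<lambda>\<beta>. u (f (k, \<beta>))" \<beta>] that by blast
  then show ?case using insert.prems(2) im by auto
qed

text \<open>The degree is bounded in each variable separately, so that for finite I there are
  exactly \<open>(n + 1) ^ card I\<close> monomials and bounds add up under multiplication. Only the
  restriction to \<open>cspace I\<close> counts, as p may involve further coordinates.\<close>

definition poly_deg :: "'i set \<Rightarrow> nat \<Rightarrow> (('i \<Rightarrow> complex) \<Rightarrow> complex) \<Rightarrow> bool" where
  "poly_deg I n p \<longleftrightarrow> (\<exists>u. \<forall>x\<in>cspace I. p x = (\<Sum>\<alpha>\<in>expos I n. u \<alpha> * monom_fun I \<alpha> x))"

lemma poly_deg_cong: "poly_deg I n q \<Longrightarrow> (\<And>x. x \<in> cspace I \<Longrightarrow> p x = q x) \<Longrightarrow> poly_deg I n p"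
  by (simp add: poly_deg_def)

lemma poly_deg_monom:
  assumes "finite I" "\<alpha> \<in> expos I n"
  shows "poly_deg I n (monom_fun I \<alpha>)"
  unfolding poly_deg_def
proof (intro exI ballI)
  fix x :: "'a \<Rightarrow> complex"
  have "(\<Sum>\<beta>\<in>expos I n. (if \<beta> = \<alpha> then 1 else 0) * monom_fun I \<beta> x) = (\<Sum>\<beta>\<in>expos I n. if \<beta> = \<alpha> then monom_fun I \<beta> x else 0)"
    by (rule sum.cong) auto
  also have "\<dots> = monom_fun I \<alpha> x"
    using assms by (simp add: sum.delta finite_PiE)
  finally show "monom_fun I \<alpha> x = (\<Sum>\<beta>\<in>expos I n. (if \<beta> = \<alpha> then 1 else 0) * monom_fun I \<beta> x)" ..
qed

lemma poly_deg_scale: "poly_deg I n p \<Longrightarrow> poly_deg I n (\<lambda>x. c * p x)"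
  unfolding poly_deg_def
  by (elim exE, rule_tac x = "\<lambda>\<alpha>. c * u \<alpha>" in exI) (simp add: sum_distrib_left mult.assoc)

lemma poly_deg_add: "poly_deg I n p \<Longrightarrow> poly_deg I n q \<Longrightarrow> poly_deg I n (\<lambda>x. p x + q x)"
  unfolding poly_deg_def
  by (elim exE, rule_tac x = "\<lambda>\<alpha>. u \<alpha> + ua \<alpha>" in exI) (simp add: sum.distrib algebra_simps)

lemma poly_deg_sum:
  "(\<And>a. a \<in> A \<Longrightarrow> poly_deg I n (f a)) \<Longrightarrow> poly_deg I n (\<lambda>x. \<Sum>a\<in>A. f a x)"
proof (induction A rule: infinite_finite_induct)
  case (insert a A)
  then show ?case using poly_deg_add[of I n "f a"] by auto
qed (auto simp: poly_deg_def intro!: exI[of _ "\<lambda>_. 0"])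

lemma poly_deg_mono:
  assumes "finite I" "poly_deg I n p" "n \<le> m"
  shows "poly_deg I m p"
proof -
  obtain u where u: "\<forall>x\<in>cspace I. p x = (\<Sum>\<alpha>\<in>expos I n. u \<alpha> * monom_fun I \<alpha> x)"
    using assms(2) by (auto simp: poly_deg_def)
  have "poly_deg I m (\<lambda>x. \<Sum>\<alpha>\<in>expos I n. u \<alpha> * monom_fun I \<alpha> x)"
    using assms by (intro poly_deg_sum poly_deg_scale poly_deg_monom) (auto simp: PiE_iff intro: order_trans)
  then show ?thesis by (rule poly_deg_cong) (use u in auto)
qed

lemma poly_deg_mult:
  assumes "finite I" "poly_deg I n p" "poly_deg I m q"
  shows "poly_deg I (n + m) (\<lambda>x. p x * q x)"
proof -
  obtain u where u: "\<forall>x\<in>cspace I. p x = (\<Sum>\<alpha>\<in>expos I n. u \<alpha> * monom_fun I \<alpha> x)"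
    using assms(2) by (auto simp: poly_deg_def)
  obtain v where v: "\<forall>x\<in>cspace I. q x = (\<Sum>\<alpha>\<in>expos I m. v \<alpha> * monom_fun I \<alpha> x)"
    using assms(3) by (auto simp: poly_deg_def)
  have "poly_deg I (n + m) (\<lambda>x. monom_fun I \<alpha> x * monom_fun I \<beta> x)"
    if "\<alpha> \<in> expos I n" "\<beta> \<in> expos I m" for \<alpha> \<beta>
  proof -
    define \<gamma> where "\<gamma> = (\<lambda>i\<in>I. \<alpha> i + \<beta> i)"
    have "monom_fun I \<alpha> x * monom_fun I \<beta> x = monom_fun I \<gamma> x" for x
      unfolding monom_fun_def \<gamma>_def by (simp add: prod.distrib[symmetric] power_add cong: prod.cong)
    moreover have "\<gamma> \<in> expos I (n + m)"
      using that by (auto simp: \<gamma>_def PiE_iff add_mono)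
    ultimately show ?thesis using poly_deg_monom assms(1) by simp
  qed
  then have "poly_deg I (n + m) (\<lambda>x. \<Sum>\<alpha>\<in>expos I n. \<Sum>\<beta>\<in>expos I m. u \<alpha> * (v \<beta> * (monom_fun I \<alpha> x * monom_fun I \<beta> x)))"
    by (intro poly_deg_sum poly_deg_scale)
  moreover have "p x * q x = (\<Sum>\<alpha>\<in>expos I n. \<Sum>\<beta>\<in>expos I m. u \<alpha> * (v \<beta> * (monom_fun I \<alpha> x * monom_fun I \<beta> x)))"
    if "x \<in> cspace I" for x
    using u v that by (simp add: sum_product mult_ac)
  ultimately show ?thesis by (rule poly_deg_cong)
qed

lemma poly_deg_const: "finite I \<Longrightarrow> poly_deg I n (\<lambda>_. c)"
proof -
  assume I: "finite I"
  have "poly_deg I n (\<lambda>x. c * monom_fun I (\<lambda>i\<in>I. 0) x)"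
    using I by (intro poly_deg_scale poly_deg_monom) auto
  moreover have "monom_fun I (\<lambda>i\<in>I. 0) x = 1" for x unfolding monom_fun_def by simp
  ultimately show ?thesis by simp
qed

lemma polyfun_poly_deg:
  assumes "p \<in> polyfun J" "finite I"
  shows "\<exists>n. poly_deg I n p"
  using assms(1)
proof induction
  case (const c)
  then show ?case using poly_deg_const assms(2) by blast
next
  case (coord j)
  show ?case
  proof (cases "j \<in> I")
    case True
    have "poly_deg I 1 (monom_fun I (\<lambda>i\<in>I. if i = j then 1 else 0))"
      using assms(2) by (intro poly_deg_monom) auto
    moreover have "monom_fun I (\<lambda>i\<in>I. if i = j then 1 else 0) x = x j" for x
    proof -
      have "monom_fun I (\<lambda>i\<in>I. if i = j then 1 else 0) x = (\<Prod>i\<in>I. if i = j then x i else 1)"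
        unfolding monom_fun_def by (rule prod.cong) auto
      then show ?thesis using True assms(2) by simp
    qed
    ultimately have "poly_deg I 1 (\<lambda>x. x j)" using poly_deg_cong[of I 1 "monom_fun I (\<lambda>i\<in>I. if i = j then 1 else 0)"] by simp
    then show ?thesis by blast
  next
    case False
    have "poly_deg I 0 (\<lambda>x. 0)" using poly_deg_const assms(2) by blast
    then have "poly_deg I 0 (\<lambda>x. x j)" by (rule poly_deg_cong) (use False in \<open>auto simp: cspaceD\<close>)
    then show ?thesis by blast
  qed
next
  case (add p q)
  then obtain n m where "poly_deg I n p" "poly_deg I m q" by blast
  then have "poly_deg I (max n m) p" "poly_deg I (max n m) q"
    using poly_deg_mono assms(2) by (meson max.cobounded1 max.cobounded2)+
  then show ?case using poly_deg_add by blast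
next
  case (mult p q)
  then show ?case using poly_deg_mult assms(2) by blast
qed

section \<open>A local inverse\<close>

text \<open>Freezing the coordinates outside the finite set J leaves finitely many radii, whose
  minimum is positive.\<close>

lemma open_contains_box:
  fixes U :: "('i \<Rightarrow> 'b :: metric_space) set"
  assumes "open U" "x \<in> U" "finite J"
  obtains \<epsilon> where "\<epsilon> > 0" "\<And>y. (\<And>j. j \<in> J \<Longrightarrow> dist (y j) (x j) < \<epsilon>) \<Longrightarrow> (\<And>j. j \<notin> J \<Longrightarrow> y j = x j) \<Longrightarrow> y \<in> U"
proof -
  have "openin (product_topology (\<lambda>_. euclidean) UNIV) U"
    using assms(1) by (simp add: euclidean_product_topology)
  then obtain X where X: "x \<in> PiE UNIV X" "\<And>i. open (X i)" "PiE UNIV X \<subseteq> U"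
    using product_topology_open_contains_basis[OF _ assms(2)] by (metis open_openin)
  have "\<exists>e>0. ball (x j) e \<subseteq> X j" for j
    using X(1,2) by (meson PiE_E UNIV_I open_contains_ball)
  then obtain e where e: "\<And>j. e j > 0" "\<And>j. ball (x j) (e j) \<subseteq> X j" by metis
  define \<epsilon> where "\<epsilon> = Min (insert 1 (e ` J))"
  have "\<epsilon> > 0" using assms(3) e(1) by (auto simp: \<epsilon>_def)
  moreover have "y \<in> U" if y: "\<And>j. j \<in> J \<Longrightarrow> dist (y j) (x j) < \<epsilon>" "\<And>j. j \<notin> J \<Longrightarrow> y j = x j" for y
  proof -
    have "y j \<in> X j" for j
    proof (cases "j \<in> J")
      case True
      have "\<epsilon> \<le> e j" using True assms(3) by (auto simp: \<epsilon>_def)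
      then have "y j \<in> ball (x j) (e j)" using y(1)[OF True] by (simp add: dist_commute)
      then show ?thesis using e(2) by blast
    next
      case False
      then show ?thesis using y(2) X(1) by auto
    qed
    then show ?thesis using X(3) by auto
  qed
  ultimately show thesis using that by blast
qed

text \<open>Tychonoff's theorem. It is applied with discs in finitely many coordinates and {0} in
  all others.\<close>

lemma compact_product_sets:
  fixes K :: "'i \<Rightarrow> 'b :: topological_space set"
  assumes "\<And>i. compact (K i)"
  shows "compact {x. \<forall>i. x i \<in> K i}"
proof -
  have "compactin (product_topology (\<lambda>_. euclidean) UNIV) (PiE UNIV K)"
    using assms by (simp add: compactin_PiE)
  moreover have "PiE UNIV K = {x. \<forall>i. x i \<in> K i}" by auto
  ultimately show ?thesis by (simp add: euclidean_product_topology)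
qed

lemma continuous_on_coord [continuous_intros]: "continuous_on S (\<lambda>x. x i)"
  by (rule continuous_on_subset[OF continuous_on_product_coordinates]) simp

lemma closed_cspace: "closed (cspace I)"
proof -
  have "cspace I = (\<Inter>i\<in>-I. {x. x i = 0})" by (auto simp: cspace_def)
  also have "closed \<dots>" by (intro closed_INT ballI closed_Collect_eq continuous_intros)
  finally show ?thesis .
qed

text \<open>The Newton map \<open>x \<mapsto> x - B (f x - s)\<close> is a contraction near \<open>x0\<close>. Its fixed point is found as a
  point of minimal displacement in a compact set, which needs no Banach space structure.\<close>

lemma local_inverse:
  fixes f :: "('i \<Rightarrow> complex) \<Rightarrow> 'i \<Rightarrow> complex"
    and T :: "('i \<Rightarrow> complex) \<Rightarrow> ('i \<Rightarrow> complex) \<Rightarrow> 'i \<Rightarrow> 'i \<Rightarrow> complex"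
  assumes fin: "finite I" and A: "open A" "x0 \<in> A" "x0 \<in> cspace I"
    and cont: "\<And>i. i \<in> I \<Longrightarrow> continuous_on A (\<lambda>x. f x i)"
    and T: "\<And>x y i. x \<in> A \<inter> cspace I \<Longrightarrow> y \<in> A \<inter> cspace I \<Longrightarrow> i \<in> I \<Longrightarrow> 
               f x i - f y i = (\<Sum>k\<in>I. T x y i k * (x k - y k))"
    and Tcont: "\<And>i k. i \<in> I \<Longrightarrow> k \<in> I \<Longrightarrow> continuous_on (A \<times> A) (\<lambda>p. T (fst p) (snd p) i k)"
    and BT: "\<And>i k. i \<in> I \<Longrightarrow> k \<in> I \<Longrightarrow> (\<Sum>l\<in>I. B i l * T x0 x0 l k) = (if i = k then 1 else 0)"
    and TB: "\<And>i k. i \<in> I \<Longrightarrow> k \<in> I \<Longrightarrow> (\<Sum>l\<in>I. T x0 x0 i l * B l k) = (if i = k then 1 else 0)"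
  obtains \<epsilon> \<delta> where "\<epsilon> > 0" "\<delta> > 0"
    "{x \<in> cspace I. \<forall>i\<in>I. dist (x i) (x0 i) < \<epsilon>} \<subseteq> A"
    "\<And>x y. x \<in> cspace I \<Longrightarrow> y \<in> cspace I \<Longrightarrow> (\<And>i. i \<in> I \<Longrightarrow> dist (x i) (x0 i) < \<epsilon>) \<Longrightarrow>
       (\<And>i. i \<in> I \<Longrightarrow> dist (y i) (x0 i) < \<epsilon>) \<Longrightarrow> (\<And>i. i \<in> I \<Longrightarrow> f x i = f y i) \<Longrightarrow> x = y"
    "\<And>s. (\<And>i. i \<in> I \<Longrightarrow> dist (s i) (f x0 i) < \<delta>) \<Longrightarrow>
       \<exists>x\<in>cspace I. (\<forall>i\<in>I. dist (x i) (x0 i) < \<epsilon>) \<and> (\<forall>i\<in>I. f x i = s i)"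
proof -
  define n where "n v = (\<Sum>i\<in>I. norm (v i))" for v :: "'i \<Rightarrow> complex"
  have n0: "n v \<ge> 0" for v unfolding n_def by (simp add: sum_nonneg)
  have nle: "norm (v i) \<le> n v" if "i \<in> I" for v i
    unfolding n_def by (rule member_le_sum) (auto simp: that fin)
  have neq0: "v i = 0" if "n v \<le> 0" "i \<in> I" for v i
    using order_trans[OF nle[OF that(2), of v] that(1)] by simp
  \<comment> \<open>The divided differences of the Newton map \<open>g\<close> defined below; on I
    they vanish at (x0, x0) because B inverts T there.\<close>
  define E where "E p i k = (if i = k then 1 else 0) - (\<Sum>l\<in>I. B i l * T (fst p) (snd p) l k)" for p i k
  \<comment> \<open>If all entries of \<open>E\<close> are below \<open>c\<close>, the sum norm
    \<open>n\<close> of a difference shrinks by the factor \<open>card I * c \<le> 1/2\<close>. The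
    added 1 covers empty I.\<close>
  define c :: real where "c = 1 / (2 * (card I + 1))"
  have c: "c > 0" by (simp add: c_def)
  have cc: "card I * c \<le> 1/2" by (simp add: c_def field_simps)
  define W where "W = (\<Inter>i\<in>I. \<Inter>k\<in>I. {p \<in> A \<times> A. norm (E p i k) < c}) \<inter> A \<times> A"
  have "open {p \<in> A \<times> A. norm (E p i k) < c}" if ik: "i \<in> I" "k \<in> I" for i k
  proof -
    have "continuous_on (A \<times> A) (\<lambda>p. norm (E p i k))"
      unfolding E_def using ik by (intro continuous_intros Tcont)
    then have "open ((\<lambda>p. norm (E p i k)) -` {..<c} \<inter> (A \<times> A))"
      using A(1) by (subst (asm) continuous_on_open_vimage) (auto simp: open_Times)
    moreover have "(\<lambda>p. norm (E p i k)) -` {..<c} \<inter> (A \<times> A) = {p \<in> A \<times> A. norm (E p i k) < c}" by auto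
    ultimately show ?thesis by simp
  qed
  then have "open W" unfolding W_def using fin A(1) by (intro open_Int open_INT ballI) (auto simp: open_Times)
  moreover have "(x0, x0) \<in> W" using A(2) BT c by (simp add: W_def E_def)
  ultimately obtain A1 A2 where A12: "open A1" "open A2" "x0 \<in> A1" "x0 \<in> A2" "A1 \<times> A2 \<subseteq> W"
    by (rule open_prod_elim) auto
  have "open (A1 \<inter> A2)" "x0 \<in> A1 \<inter> A2" using A12 by auto
  then obtain \<epsilon> where \<epsilon>: "\<epsilon> > 0"
    "\<And>y. (\<And>j. j \<in> I \<Longrightarrow> dist (y j) (x0 j) < \<epsilon>) \<Longrightarrow> (\<And>j. j \<notin> I \<Longrightarrow> y j = x0 j) \<Longrightarrow> y \<in> A1 \<inter> A2"
    using open_contains_box fin by blast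
  define N where "N = {x \<in> cspace I. \<forall>i\<in>I. dist (x i) (x0 i) < \<epsilon>}"
  have NW: "(x, y) \<in> W" if "x \<in> N" "y \<in> N" for x y
  proof -
    have "z \<in> A1 \<inter> A2" if "z \<in> N" for z
      by (rule \<epsilon>(2)) (use that in \<open>auto simp: N_def cspaceD[OF A(3)] cspaceD\<close>)
    then show ?thesis using A12(5) that by blast
  qed
  then have NA: "N \<subseteq> A" by (auto simp: W_def)
  define g where "g s x = (\<lambda>i. if i \<in> I then x i - (\<Sum>l\<in>I. B i l * (f x l - s l)) else 0)" for s x
  have gdiff: "g s x i - g s y i = (\<Sum>k\<in>I. E (x, y) i k * (x k - y k))" if "x \<in> N" "y \<in> N" "i \<in> I" for s x y i
  proof -
    have "(\<Sum>l\<in>I. B i l * (f x l - s l)) - (\<Sum>l\<in>I. B i l * (f y l - s l)) = (\<Sum>l\<in>I. B i l * (f x l - f y l))"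
      by (simp add: sum_subtractf[symmetric] algebra_simps)
    also have "\<dots> = (\<Sum>l\<in>I. B i l * (\<Sum>k\<in>I. T x y l k * (x k - y k)))"
      using that NA by (intro sum.cong refl) (auto simp: T N_def subset_iff)
    also have "\<dots> = (\<Sum>k\<in>I. (\<Sum>l\<in>I. B i l * T x y l k) * (x k - y k))"
      unfolding sum_distrib_left sum_distrib_right by (subst sum.swap) (simp add: mult_ac)
    finally have eq: "(\<Sum>l\<in>I. B i l * (f x l - s l)) - (\<Sum>l\<in>I. B i l * (f y l - s l)) = \<dots>" .
    have "g s x i - g s y i = (x i - y i) - ((\<Sum>l\<in>I. B i l * (f x l - s l)) - (\<Sum>l\<in>I. B i l * (f y l - s l)))"
      using that(3) by (simp add: g_def)
    also have "\<dots> = (x i - y i) - (\<Sum>k\<in>I. (\<Sum>l\<in>I. B i l * T x y l k) * (x k - y k))"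
      by (simp only: eq)
    finally have "g s x i - g s y i = (x i - y i) - (\<Sum>k\<in>I. (\<Sum>l\<in>I. B i l * T x y l k) * (x k - y k))" .
    moreover have "x i - y i = (\<Sum>k\<in>I. (if i = k then 1 else 0) * (x k - y k))"
    proof -
      have "(\<Sum>k\<in>I. (if i = k then 1 else 0) * (x k - y k)) = (\<Sum>k\<in>I. if i = k then x k - y k else 0)"
        by (rule sum.cong) auto
      then show ?thesis using that(3) fin by simp
    qed
    ultimately show ?thesis by (simp add: E_def sum_subtractf[symmetric] left_diff_distrib)
  qed
  have contr: "n (\<lambda>i. g s x i - g s y i) \<le> 1/2 * n (\<lambda>i. x i - y i)" if "x \<in> N" "y \<in> N" for s x y
  proof -
    have "norm (g s x i - g s y i) \<le> c * n (\<lambda>i. x i - y i)" if i: "i \<in> I" for i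
    proof -
      have "norm (g s x i - g s y i) \<le> (\<Sum>k\<in>I. norm (E (x, y) i k * (x k - y k)))"
        unfolding gdiff[OF \<open>x \<in> N\<close> \<open>y \<in> N\<close> i] by (rule norm_sum)
      also have "\<dots> \<le> (\<Sum>k\<in>I. c * norm (x k - y k))"
      proof (rule sum_mono)
        fix k assume "k \<in> I"
        then have "norm (E (x, y) i k) \<le> c" using NW[OF \<open>x \<in> N\<close> \<open>y \<in> N\<close>] i unfolding W_def by force
        then show "norm (E (x, y) i k * (x k - y k)) \<le> c * norm (x k - y k)"
          by (simp add: norm_mult mult_right_mono)
      qed
      finally show ?thesis by (simp add: n_def sum_distrib_left)
    qed
    then have "n (\<lambda>i. g s x i - g s y i) \<le> card I * (c * n (\<lambda>i. x i - y i))"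
      unfolding n_def[of "\<lambda>i. g s x i - g s y i"] by (rule sum_bounded_above)
    also have "\<dots> \<le> 1/2 * n (\<lambda>i. x i - y i)"
      using mult_right_mono[OF cc n0] by (simp add: mult.assoc)
    finally show ?thesis .
  qed
  define r where "r = \<epsilon> / 2"
  have r: "r > 0" "r < \<epsilon>" using \<epsilon>(1) by (auto simp: r_def)
  define b where "b = (\<Sum>i\<in>I. \<Sum>l\<in>I. norm (B i l))"
  have b: "b \<ge> 0" unfolding b_def by (simp add: sum_nonneg)
  \<comment> \<open>Makes the first Newton step from x0 at most r / 2 long; a contraction by 1/2
    then maps the ball of radius r into itself.\<close>
  define \<delta> where "\<delta> = r / (2 * (b + 1))"
  have \<delta>: "\<delta> > 0" using r b by (simp add: \<delta>_def)
  have b\<delta>: "b * \<delta> \<le> r / 2" using r b by (simp add: \<delta>_def field_simps)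
  \<comment> \<open>The closed ball of radius r in the sum norm. The box is there for compactness,
    the second condition for invariance under \<open>g\<close>.\<close>
  define K where "K = {x. \<forall>i. x i \<in> (if i \<in> I then cball (x0 i) r else {0})} \<inter> {x. n (\<lambda>i. x i - x0 i) \<le> r}"
  have KN: "K \<subseteq> N"
  proof
    fix x assume x: "x \<in> K"
    have mem: "x i \<in> (if i \<in> I then cball (x0 i) r else {0})" for i using x unfolding K_def by blast
    have "x i = 0" if "i \<notin> I" for i using mem[of i] that by simp
    moreover have "dist (x i) (x0 i) < \<epsilon>" if "i \<in> I" for i using mem[of i] that r(2) by (simp add: dist_commute)
    ultimately show "x \<in> N" by (simp add: N_def cspace_def)
  qed
  have Kmem: "x \<in> K" if "x \<in> cspace I" "n (\<lambda>i. x i - x0 i) \<le> r" for x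
    using that nle[of _ "\<lambda>i. x i - x0 i"] by (force simp: K_def cspace_def dist_norm norm_minus_commute)
  have "compact K"
    unfolding K_def n_def
    by (intro compact_Int_closed compact_product_sets closed_Collect_le continuous_intros) auto
  have surj: "\<exists>x\<in>cspace I. (\<forall>i\<in>I. dist (x i) (x0 i) < \<epsilon>) \<and> (\<forall>i\<in>I. f x i = s i)"
    if s: "\<And>i. i \<in> I \<Longrightarrow> dist (s i) (f x0 i) < \<delta>" for s
  proof -
    have x0: "x0 \<in> K" using Kmem[OF A(3)] r by (simp add: n_def)
    have g0: "n (\<lambda>i. g s x0 i - x0 i) \<le> r / 2"
    proof -
      have "norm (g s x0 i - x0 i) \<le> (\<Sum>l\<in>I. norm (B i l) * \<delta>)" if "i \<in> I" for i
      proof -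
        have "norm (g s x0 i - x0 i) = norm (\<Sum>l\<in>I. B i l * (f x0 l - s l))" using that by (simp add: g_def)
        also have "\<dots> \<le> (\<Sum>l\<in>I. norm (B i l) * \<delta>)"
        proof (rule sum_norm_le)
          fix l assume "l \<in> I"
          then have "norm (f x0 l - s l) \<le> \<delta>" using s[of l] by (simp add: dist_norm norm_minus_commute)
          then show "norm (B i l * (f x0 l - s l)) \<le> norm (B i l) * \<delta>" by (simp add: norm_mult mult_left_mono)
        qed
        finally show ?thesis .
      qed
      then have "n (\<lambda>i. g s x0 i - x0 i) \<le> (\<Sum>i\<in>I. \<Sum>l\<in>I. norm (B i l) * \<delta>)"
        unfolding n_def by (rule sum_mono)
      also have "\<dots> = b * \<delta>" by (simp add: b_def sum_distrib_right)
      finally show ?thesis using b\<delta> by linarith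
    qed
    have gK: "g s x \<in> K" if x: "x \<in> K" for x
    proof (rule Kmem)
      show "g s x \<in> cspace I" by (simp add: g_def cspace_def)
      have "n (\<lambda>i. g s x i - x0 i) \<le> n (\<lambda>i. g s x i - g s x0 i) + n (\<lambda>i. g s x0 i - x0 i)"
        unfolding n_def sum.distrib[symmetric]
        by (rule sum_mono) (metis diff_add_cancel add_diff_eq norm_triangle_ineq)
      also have "n (\<lambda>i. g s x i - g s x0 i) \<le> 1/2 * n (\<lambda>i. x i - x0 i)"
        using contr x x0 KN by blast
      also have "n (\<lambda>i. x i - x0 i) \<le> r" using x by (simp add: K_def)
      finally show "n (\<lambda>i. g s x i - x0 i) \<le> r" using g0 by simp
    qed
    have "continuous_on K (\<lambda>x. n (\<lambda>i. x i - g s x i))"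
      unfolding n_def g_def using KN NA
      by (auto intro!: continuous_intros continuous_on_subset[OF cont])
    then obtain x where x: "x \<in> K" "\<And>y. y \<in> K \<Longrightarrow> n (\<lambda>i. x i - g s x i) \<le> n (\<lambda>i. y i - g s y i)"
      using continuous_attains_inf[OF \<open>compact K\<close>] x0 by blast
    \<comment> \<open>Another Newton step at least halves the displacement, so the minimal
      displacement is 0.\<close>
    have "n (\<lambda>i. x i - g s x i) \<le> n (\<lambda>i. g s x i - g s (g s x) i)" using x gK by blast
    also have "\<dots> \<le> 1/2 * n (\<lambda>i. x i - g s x i)" using contr x(1) gK KN by blast
    finally have fix0: "n (\<lambda>i. x i - g s x i) \<le> 0" by simp
    have zero: "(\<Sum>l\<in>I. B i l * (f x l - s l)) = 0" if "i \<in> I" for i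
      using neq0[OF fix0 that] that by (simp add: g_def)
    have "f x i = s i" if i: "i \<in> I" for i
    proof -
      have "0 = (\<Sum>l\<in>I. T x0 x0 i l * (\<Sum>k\<in>I. B l k * (f x k - s k)))" using zero by simp
      also have "\<dots> = (\<Sum>k\<in>I. (\<Sum>l\<in>I. T x0 x0 i l * B l k) * (f x k - s k))"
        unfolding sum_distrib_left sum_distrib_right by (subst sum.swap) (simp add: mult_ac)
      also have "\<dots> = (\<Sum>k\<in>I. if i = k then f x k - s k else 0)"
        using TB i by (intro sum.cong) auto
      also have "\<dots> = f x i - s i" using i fin by simp
      finally show ?thesis by simp
    qed
    then show ?thesis using x(1) KN by (auto simp: N_def)
  qed
  have inj: "x = y" if "x \<in> N" "y \<in> N" "\<And>i. i \<in> I \<Longrightarrow> f x i = f y i" for x y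
  proof -
    \<comment> \<open>If f x = f y, the Newton map preserves the difference of x and y, which the
      contraction then forces to be 0.\<close>
    have "n (\<lambda>i. g (\<lambda>_. 0) x i - g (\<lambda>_. 0) y i) = n (\<lambda>i. x i - y i)"
      unfolding n_def by (rule sum.cong) (use that(3) in \<open>auto simp: g_def\<close>)
    then have "n (\<lambda>i. x i - y i) \<le> 0" using contr[OF that(1,2), of "\<lambda>_. 0"] n0[of "\<lambda>i. x i - y i"] by simp
    then show ?thesis using that(1,2) neq0[of "\<lambda>i. x i - y i"] by (intro cspace_eqI[of x I y]) (auto simp: N_def)
  qed
  show thesis
    by (rule that[OF \<epsilon>(1) \<delta>]) (use NA inj surj in \<open>auto simp: N_def\<close>)
qed

section \<open>Determinants and adjugates over a finite index set\<close>

lemma poly_functions_sum: "(\<And>a. a \<in> A \<Longrightarrow> f a \<in> poly_functions V) \<Longrightarrow> (\<lambda>M. \<Sum>a\<in>A. f a M) \<in> poly_functions V"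
  by (induction A rule: infinite_finite_induct) (auto intro: poly_functions.intros)

lemma poly_functions_prod: "(\<And>a. a \<in> A \<Longrightarrow> f a \<in> poly_functions V) \<Longrightarrow> (\<lambda>M. \<Prod>a\<in>A. f a M) \<in> poly_functions V"
  by (induction A rule: infinite_finite_induct) (auto intro: poly_functions.intros)

lemma poly_functions_det:
  assumes "\<And>M. F M \<in> carrier_mat k k" "\<And>i j. i < k \<Longrightarrow> j < k \<Longrightarrow> (\<lambda>M. F M $$ (i, j)) \<in> poly_functions V"
  shows "(\<lambda>M. Determinant.det (F M)) \<in> poly_functions V"
proof -
  have "(\<lambda>M. \<Prod>i = 0..<k. F M $$ (i, p i)) \<in> poly_functions V" if "p permutes {0..<k}" for p
    using that permutes_in_image[OF that] by (intro poly_functions_prod assms(2)) auto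
  then show ?thesis
    unfolding det_def'[OF assms(1)]
    by (intro poly_functions_sum poly_functions.mult poly_functions.const) auto
qed

text \<open>An arbitrary enumeration, through which determinants and adjugates are transported from
  matrices indexed by numbers.\<close>

definition enum :: "'a set \<Rightarrow> nat \<Rightarrow> 'a" where
  "enum V = (SOME e. bij_betw e {0..<card V} V)"

definition to_mat :: "'a set \<Rightarrow> ('a \<Rightarrow> 'a \<Rightarrow> complex) \<Rightarrow> complex Matrix.mat" where
  "to_mat V M = Matrix.mat (card V) (card V) (\<lambda>(i, j). M (enum V i) (enum V j))"

definition det_on :: "'a set \<Rightarrow> ('a \<Rightarrow> 'a \<Rightarrow> complex) \<Rightarrow> complex" where
  "det_on V M = Determinant.det (to_mat V M)"

definition adj_on :: "'a set \<Rightarrow> ('a \<Rightarrow> 'a \<Rightarrow> complex) \<Rightarrow> 'a \<Rightarrow> 'a \<Rightarrow> complex" where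
  "adj_on V M a b = adj_mat (to_mat V M) $$ (inv_into {0..<card V} (enum V) a, inv_into {0..<card V} (enum V) b)"

context
  fixes V :: "'a set"
  assumes fin: "finite V"
begin

lemma bij_enum: "bij_betw (enum V) {0..<card V} V"
  unfolding enum_def by (rule someI_ex[OF ex_bij_betw_nat_finite[OF fin]])

lemma enum_in: "i < card V \<Longrightarrow> enum V i \<in> V"
  using bij_enum by (auto simp: bij_betw_def)

lemma obtain_enum: "a \<in> V \<Longrightarrow> \<exists>i < card V. a = enum V i"
  using bij_enum by (force simp: bij_betw_def)

lemma inv_enum: "i < card V \<Longrightarrow> inv_into {0..<card V} (enum V) (enum V i) = i"
  using bij_enum by (simp add: bij_betw_def)

lemma enum_eq: "i < card V \<Longrightarrow> j < card V \<Longrightarrow> enum V i = enum V j \<longleftrightarrow> i = j"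
  by (metis inv_enum)

lemma sum_enum: "(\<Sum>k\<in>V. f k) = (\<Sum>k = 0..<card V. f (enum V k))"
  using sum.reindex_bij_betw[OF bij_enum, of f] by simp

lemma to_mat_carrier [simp]: "to_mat V M \<in> carrier_mat (card V) (card V)"
  by (simp add: to_mat_def)

lemma to_mat_index [simp]: "i < card V \<Longrightarrow> j < card V \<Longrightarrow> to_mat V M $$ (i, j) = M (enum V i) (enum V j)"
  by (simp add: to_mat_def)

lemma det_on_poly: "det_on V \<in> poly_functions V"
  unfolding det_on_def[abs_def]
  by (rule poly_functions_det[where k = "card V"]) (auto intro!: poly_functions.entry enum_in)

lemma adj_on_poly:
  assumes "a \<in> V" "b \<in> V"
  shows "(\<lambda>M. adj_on V M a b) \<in> poly_functions V"
proof -
  obtain i j where ij: "i < card V" "a = enum V i" "j < card V" "b = enum V j"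
    using obtain_enum assms by metis
  have "adj_on V M a b = (-1) ^ (j + i) * Determinant.det (mat_delete (to_mat V M) j i)" for M
    using ij by (simp add: adj_on_def inv_enum adj_mat_def cofactor_def to_mat_def)
  moreover have "(\<lambda>M. Determinant.det (mat_delete (to_mat V M) j i)) \<in> poly_functions V"
  proof (rule poly_functions_det[where k = "card V - 1"])
    show "mat_delete (to_mat V M) j i \<in> carrier_mat (card V - 1) (card V - 1)" for M
      by (intro mat_delete_carrier to_mat_carrier)
    show "(\<lambda>M. mat_delete (to_mat V M) j i $$ (i', j')) \<in> poly_functions V"
      if "i' < card V - 1" "j' < card V - 1" for i' j'
      using that by (auto simp: mat_delete_def to_mat_def intro!: poly_functions.entry enum_in)
  qed
  ultimately show ?thesis by (simp add: poly_functions.mult poly_functions.const)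
qed

lemma adj_on_right:
  assumes "a \<in> V" "b \<in> V"
  shows "(\<Sum>k\<in>V. M a k * adj_on V M k b) = (if a = b then det_on V M else 0)"
proof -
  obtain i j where ij: "i < card V" "a = enum V i" "j < card V" "b = enum V j"
    using obtain_enum assms by metis
  note adj = adj_mat[OF to_mat_carrier[of M]]
  have "(\<Sum>k\<in>V. M a k * adj_on V M k b) = (to_mat V M * adj_mat (to_mat V M)) $$ (i, j)"
    using ij adj(1) carrier_matD[OF adj(1)] carrier_matD[OF to_mat_carrier[of M]]
    by (simp add: sum_enum adj_on_def inv_enum scalar_prod_def)
  also have "\<dots> = (if a = b then det_on V M else 0)"
    using ij by (simp add: adj(2) det_on_def enum_eq)
  finally show ?thesis .
qed

lemma adj_on_left:
  assumes "a \<in> V" "b \<in> V"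
  shows "(\<Sum>k\<in>V. adj_on V M a k * M k b) = (if a = b then det_on V M else 0)"
proof -
  obtain i j where ij: "i < card V" "a = enum V i" "j < card V" "b = enum V j"
    using obtain_enum assms by metis
  note adj = adj_mat[OF to_mat_carrier[of M]]
  have "(\<Sum>k\<in>V. adj_on V M a k * M k b) = (adj_mat (to_mat V M) * to_mat V M) $$ (i, j)"
    using ij adj(1) carrier_matD[OF adj(1)] carrier_matD[OF to_mat_carrier[of M]]
    by (simp add: sum_enum adj_on_def inv_enum scalar_prod_def)
  also have "\<dots> = (if a = b then det_on V M else 0)"
    using ij by (simp add: adj(3) det_on_def enum_eq)
  finally show ?thesis .
qed

lemma det_on_inverse:
  assumes "\<And>a b. a \<in> V \<Longrightarrow> b \<in> V \<Longrightarrow> (\<Sum>k\<in>V. M a k * N k b) = (if a = b then 1 else 0)"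
  shows "det_on V M * det_on V N = 1"
proof -
  have "to_mat V M * to_mat V N = 1\<^sub>m (card V)"
  proof (rule eq_matI)
    fix i j assume "i < dim_row (1\<^sub>m (card V))" "j < dim_col (1\<^sub>m (card V))"
    then have ij: "i < card V" "j < card V" by auto
    then have "(to_mat V M * to_mat V N) $$ (i, j) = (\<Sum>k\<in>V. M (enum V i) k * N k (enum V j))"
      using carrier_matD[OF to_mat_carrier[of M]] carrier_matD[OF to_mat_carrier[of N]]
      by (simp add: sum_enum scalar_prod_def)
    then show "(to_mat V M * to_mat V N) $$ (i, j) = 1\<^sub>m (card V) $$ (i, j)"
      using ij assms[OF enum_in enum_in] by (simp add: enum_eq)
  qed (use carrier_matD[OF to_mat_carrier[of M]] carrier_matD[OF to_mat_carrier[of N]] in auto)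
  then show ?thesis
    unfolding det_on_def by (metis det_mult det_one to_mat_carrier)
qed

end

section \<open>The closure of a linear space under a rational involution\<close>

lemma poly_deg_power:
  assumes "finite I" "poly_deg I n p"
  shows "poly_deg I (k * n) (\<lambda>x. p x ^ k)"
  by (induction k) (use assms in \<open>auto intro: poly_deg_const poly_deg_mult\<close>)

lemma poly_deg_prod:
  assumes "finite I" "\<And>a. a \<in> A \<Longrightarrow> poly_deg I n (f a)"
  shows "poly_deg I (card A * n) (\<lambda>x. \<Prod>a\<in>A. f a x)"
  using assms(2)
proof (induction A rule: infinite_finite_induct)
  case (insert a A)
  have "poly_deg I (n + card A * n) (\<lambda>x. f a x * (\<Prod>a\<in>A. f a x))"
    using insert by (intro poly_deg_mult assms(1)) auto
  then show ?case using insert by simp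
qed (auto intro: poly_deg_const assms(1))

text \<open>Iterates the fact that two nonempty basic open sets meet.\<close>

lemma polyfun_prod_nonzero:
  assumes "finite A" "\<And>a. a \<in> A \<Longrightarrow> f a \<in> polyfun I" "\<And>a. a \<in> A \<Longrightarrow> \<exists>s\<in>cspace J. f a s \<noteq> 0"
  shows "\<exists>s\<in>cspace J. (\<Prod>a\<in>A. f a s) \<noteq> 0"
  using assms
proof (induction A rule: finite_induct)
  case empty
  then show ?case by (auto simp: cspace_def intro!: exI[of _ "\<lambda>_. 0"])
next
  case (insert a A)
  then obtain s t where st: "s \<in> cspace J" "f a s \<noteq> 0" "t \<in> cspace J" "(\<Prod>a\<in>A. f a t) \<noteq> 0"
    by (metis insertCI)
  have "(\<lambda>x. \<Prod>a\<in>A. f a x) \<in> polyfun I" using insert.prems by (intro polyfun_prod) auto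
  then obtain z where "f a (line s t z) \<noteq> 0" "(\<Prod>a\<in>A. f a (line s t z)) \<noteq> 0"
    using polyfun_nonzero_near[of "f a" I s "\<lambda>x. \<Prod>a\<in>A. f a x" I t "{}" 1] insert.prems st by auto
  then show ?case using st insert.hyps by (auto intro!: bexI[of _ "line s t z"] line_in_cspace)
qed

text \<open>If norm t exceeds 1, all lower powers are at most \<open>norm t ^ (r - 1)\<close>, which
  can be cancelled. The bound is continuous in the coefficients as long as
  \<open>c r \<noteq> 0\<close>; local boundedness of the fibres rests on this.\<close>

lemma root_bound:
  fixes c :: "nat \<Rightarrow> complex"
  assumes "c r \<noteq> 0" "(\<Sum>k\<le>r. c k * t ^ k) = 0"
  shows "norm t \<le> 1 + (\<Sum>k<r. norm (c k)) / norm (c r)"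
proof (cases "norm t \<le> 1")
  case True
  then show ?thesis by (smt (verit) divide_nonneg_nonneg norm_ge_zero sum_nonneg)
next
  case False
  have "r \<noteq> 0" using assms by (intro notI) simp
  then obtain q where r: "r = Suc q" by (cases r) auto
  have "c r * t ^ r = - (\<Sum>k<r. c k * t ^ k)"
    using assms(2) by (simp add: lessThan_Suc_atMost[symmetric] add_eq_0_iff)
  then have "norm (c r) * norm t ^ r = norm (\<Sum>k<r. c k * t ^ k)"
    by (metis norm_minus_cancel norm_mult norm_power)
  also have "\<dots> \<le> (\<Sum>k<r. norm (c k) * norm t ^ q)"
  proof (rule sum_norm_le)
    fix k assume "k \<in> {..<r}"
    then have "norm t ^ k \<le> norm t ^ q" using False r by (intro power_increasing) auto
    then show "norm (c k * t ^ k) \<le> norm (c k) * norm t ^ q"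
      by (simp add: norm_mult norm_power mult_left_mono)
  qed
  also have "\<dots> = (\<Sum>k<r. norm (c k)) * norm t ^ q" by (simp add: sum_distrib_right)
  finally have "norm t ^ q * (norm (c r) * norm t) \<le> norm t ^ q * (\<Sum>k<r. norm (c k))"
    by (simp add: r mult_ac)
  moreover have "norm t ^ q > 0" using False by (intro zero_less_power) linarith
  ultimately have "norm (c r) * norm t \<le> (\<Sum>k<r. norm (c k))" by simp
  then have "norm t \<le> (\<Sum>k<r. norm (c k)) / norm (c r)"
    using assms(1) by (simp add: pos_le_divide_eq mult.commute)
  then show ?thesis by simp
qed

lemma finite_roots:
  fixes c :: "nat \<Rightarrow> complex"
  assumes "c r \<noteq> 0"
  shows "finite {t. (\<Sum>k\<le>r. c k * t ^ k) = 0}"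
  using polyfun_rootbound_finite assms by blast

text \<open>The coordinates \<open>J\<close> stand for the entries of a symmetric matrix, \<open>I\<close> for those on the diagonal and the
  edges, \<open>h\<close> for the determinant, \<open>\<iota>\<close> for the inversion and \<open>e\<close> for the identity matrix. The matrix
  \<open>\<tau>\<close> of divided differences of \<open>\<iota>\<close> specialises to its Jacobian on the diagonal.\<close>

locale rational_involution =
  fixes J I :: "'i set" and h :: "('i \<Rightarrow> complex) \<Rightarrow> complex" and R :: "'i \<Rightarrow> ('i \<Rightarrow> complex) \<Rightarrow> complex"
    and \<tau> :: "('i \<Rightarrow> complex) \<Rightarrow> ('i \<Rightarrow> complex) \<Rightarrow> 'i \<Rightarrow> 'i \<Rightarrow> complex"
    and \<iota> :: "('i \<Rightarrow> complex) \<Rightarrow> 'i \<Rightarrow> complex"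
    and e :: "'i \<Rightarrow> complex"
  assumes finJ: "finite J" and IJ: "I \<subseteq> J"
    and h_poly: "h \<in> polyfun J" and R_poly: "\<And>j. j \<in> J \<Longrightarrow> R j \<in> polyfun J"
    and \<iota>_eq: "\<And>x. \<iota> x = (\<lambda>j. if j \<in> J then R j x / h x else 0)"
    and h_\<iota>: "\<And>x. x \<in> cspace J \<Longrightarrow> h x \<noteq> 0 \<Longrightarrow> h (\<iota> x) \<noteq> 0"
    and \<iota>_\<iota>: "\<And>x. x \<in> cspace J \<Longrightarrow> h x \<noteq> 0 \<Longrightarrow> \<iota> (\<iota> x) = x"
    and \<iota>_diff: "\<And>x y j. x \<in> cspace J \<Longrightarrow> y \<in> cspace J \<Longrightarrow> h x \<noteq> 0 \<Longrightarrow> h y \<noteq> 0 \<Longrightarrow> j \<in> J \<Longrightarrow>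
      \<iota> x j - \<iota> y j = (\<Sum>k\<in>J. \<tau> (\<iota> x) (\<iota> y) j k * (x k - y k))"
    and \<tau>_cont: "\<And>j k S. j \<in> J \<Longrightarrow> k \<in> J \<Longrightarrow> continuous_on S (\<lambda>p. \<tau> (fst p) (snd p) j k)"
    and \<tau>_poly: "\<And>j k. j \<in> J \<Longrightarrow> k \<in> J \<Longrightarrow> (\<lambda>N. \<tau> N N j k) \<in> polyfun J"
    and e: "e \<in> cspace I" "h e \<noteq> 0" "det_on I (\<tau> (\<iota> e) (\<iota> e)) \<noteq> 0"
begin

section \<open>The image of the involution and its Zariski closure\<close>

definition Y where "Y = {\<iota> x | x. x \<in> cspace I \<and> h x \<noteq> 0}"

definition X where "X = {N \<in> cspace J. \<forall>p\<in>polyfun J. (\<forall>N'\<in>Y. p N' = 0) \<longrightarrow> p N = 0}"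

definition fibre where "fibre s = {N \<in> X. \<forall>i\<in>I. N i = s i}"

text \<open>The Jacobian determinant of the I-coordinates of \<open>\<iota>\<close> on
  \<open>cspace I\<close>, taken at x but written in terms of \<open>N = \<iota> x\<close>. In this
  form it is a polynomial that makes sense on all of \<open>X\<close>.\<close>

definition jac where "jac N = det_on I (\<tau> N N)"

lemma finI: "finite I" using finJ IJ finite_subset by blast

lemma cspace_IJ: "x \<in> cspace I \<Longrightarrow> x \<in> cspace J"
  using cspace_mono[OF IJ] by blast

lemma \<iota>_cspace: "\<iota> x \<in> cspace J"
  by (simp add: \<iota>_eq cspace_def)

lemma Y_X: "Y \<subseteq> X"
  by (auto simp: X_def Y_def \<iota>_cspace)

lemma X_poly: "p \<in> polyfun J \<Longrightarrow> (\<And>N. N \<in> Y \<Longrightarrow> p N = 0) \<Longrightarrow> N \<in> X \<Longrightarrow> p N = 0"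
  by (simp add: X_def)

lemma X_cspace: "N \<in> X \<Longrightarrow> N \<in> cspace J"
  by (simp add: X_def)

text \<open>For j outside I the numerator \<open>R j\<close> vanishes on \<open>Y\<close>, since
  \<open>\<iota>\<close> is an involution, and hence on the closure. So taking the closure adds no
  new points with \<open>h N \<noteq> 0\<close>.\<close>

lemma X_\<iota>:
  assumes "N \<in> X" "h N \<noteq> 0"
  shows "\<iota> N \<in> cspace I"
proof -
  have "\<iota> N j = 0" if "j \<notin> I" for j
  proof (cases "j \<in> J")
    case True
    have "R j N' = 0" if "N' \<in> Y" for N'
    proof -
      from \<open>N' \<in> Y\<close> obtain x where x: "x \<in> cspace I" "h x \<noteq> 0" "N' = \<iota> x" unfolding Y_def by blast
      have "R j N' / h N' = x j"
        using \<iota>_\<iota>[OF cspace_IJ[OF x(1)] x(2)] x(3) True by (metis \<iota>_eq)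
      then show ?thesis
        using x \<open>j \<notin> I\<close> h_\<iota>[OF cspace_IJ[OF x(1)] x(2)] by (simp add: cspaceD)
    qed
    then have "R j N = 0" using X_poly[OF R_poly[OF True]] assms(1) by blast
    then show ?thesis by (simp add: \<iota>_eq)
  qed (simp add: \<iota>_eq)
  then show ?thesis by (simp add: cspace_def)
qed

text \<open>Clearing denominators turns polynomial conditions on \<open>Y\<close> into polynomial
  conditions on the affine space that parametrises it, where lines are available.\<close>

lemma pullback:
  assumes "g \<in> polyfun J"
  shows "\<exists>G\<in>polyfun J. \<exists>b. \<forall>x. h x \<noteq> 0 \<longrightarrow> g (\<iota> x) * h x ^ b = G x"
  using assms
proof induction
  case (const c)
  show ?case by (rule bexI[of _ "\<lambda>_. c"], rule exI[of _ 0]) (auto intro: polyfun.const)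
next
  case (coord j)
  show ?case using coord by (intro bexI[of _ "R j"] exI[of _ 1]) (auto simp: \<iota>_eq R_poly)
next
  case (add p q)
  then obtain P Q b c where P: "P \<in> polyfun J" "\<And>x. h x \<noteq> 0 \<Longrightarrow> p (\<iota> x) * h x ^ b = P x"
    and Q: "Q \<in> polyfun J" "\<And>x. h x \<noteq> 0 \<Longrightarrow> q (\<iota> x) * h x ^ c = Q x" by metis
  have "(p (\<iota> x) + q (\<iota> x)) * h x ^ (b + c) = P x * h x ^ c + Q x * h x ^ b" if "h x \<noteq> 0" for x
    by (simp add: P(2)[OF that, symmetric] Q(2)[OF that, symmetric] power_add algebra_simps)
  moreover have "(\<lambda>x. P x * h x ^ c + Q x * h x ^ b) \<in> polyfun J"
    by (intro polyfun.add polyfun.mult polyfun_power P(1) Q(1) h_poly)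
  ultimately show ?case
    by (intro bexI[of _ "\<lambda>x. P x * h x ^ c + Q x * h x ^ b"] exI[of _ "b + c"]) auto
next
  case (mult p q)
  then obtain P Q b c where P: "P \<in> polyfun J" "\<And>x. h x \<noteq> 0 \<Longrightarrow> p (\<iota> x) * h x ^ b = P x"
    and Q: "Q \<in> polyfun J" "\<And>x. h x \<noteq> 0 \<Longrightarrow> q (\<iota> x) * h x ^ c = Q x" by metis
  have "(p (\<iota> x) * q (\<iota> x)) * h x ^ (b + c) = P x * Q x" if "h x \<noteq> 0" for x
    by (simp add: P(2)[OF that, symmetric] Q(2)[OF that, symmetric] power_add algebra_simps)
  moreover have "(\<lambda>x. P x * Q x) \<in> polyfun J"
    by (intro polyfun.mult P(1) Q(1))
  ultimately show ?case
    by (intro bexI[of _ "\<lambda>x. P x * Q x"] exI[of _ "b + c"]) auto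
qed

text \<open>\<open>Y\<close> is parametrised by a basic open set of an affine space. If neither
  factor vanished on all of \<open>Y\<close>, the line through the two parameters would contain a
  point where both are nonzero.\<close>

lemma Y_irreducible:
  assumes "p \<in> polyfun J" "q \<in> polyfun J" "\<And>N. N \<in> Y \<Longrightarrow> p N * q N = 0" "N0 \<in> Y" "q N0 \<noteq> 0" "N \<in> Y"
  shows "p N = 0"
proof (rule ccontr)
  assume "p N \<noteq> 0"
  obtain P b where P: "P \<in> polyfun J" "\<And>x. h x \<noteq> 0 \<Longrightarrow> p (\<iota> x) * h x ^ b = P x"
    using pullback[OF assms(1)] by metis
  obtain Q c where Q: "Q \<in> polyfun J" "\<And>x. h x \<noteq> 0 \<Longrightarrow> q (\<iota> x) * h x ^ c = Q x"
    using pullback[OF assms(2)] by metis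
  obtain x y where x: "x \<in> cspace I" "h x \<noteq> 0" "N0 = \<iota> x" and y: "y \<in> cspace I" "h y \<noteq> 0" "N = \<iota> y"
    using assms by (auto simp: Y_def)
  \<comment> \<open>The extra factor h keeps the chosen point of the line in the domain of the
    parametrisation.\<close>
  have "Q x * h x \<noteq> 0" using x assms(5) Q(2)[OF x(2)] by auto
  moreover have "P y \<noteq> 0" using y \<open>p N \<noteq> 0\<close> P(2)[OF y(2)] by auto
  moreover have "(\<lambda>x. Q x * h x) \<in> polyfun J" using Q(1) h_poly by (rule polyfun.mult)
  ultimately obtain z where z: "Q (line x y z) * h (line x y z) \<noteq> 0" "P (line x y z) \<noteq> 0"
    using polyfun_nonzero_near[OF _ _ P(1), of "\<lambda>x. Q x * h x" J x y "{}" 1] by auto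
  let ?w = "line x y z"
  have "?w \<in> cspace I" "h ?w \<noteq> 0" using line_in_cspace x y z by auto
  then have "p (\<iota> ?w) * q (\<iota> ?w) = 0" using assms(3) by (auto simp: Y_def)
  moreover have "p (\<iota> ?w) \<noteq> 0" "q (\<iota> ?w) \<noteq> 0"
    using P(2)[of ?w] Q(2)[of ?w] z by auto
  ultimately show False by simp
qed

text \<open>After clearing denominators, the monomials of degree at most \<open>n\<close> in the coordinates in \<open>I\<close> and
  in \<open>g\<close> lie in a space of dimension \<open>O(n ^ card I)\<close>, but there are \<open>(n + 1) ^ (card I + 1)\<close> of them.\<close>

lemma algebraic_relation:
  assumes g: "g \<in> polyfun J"
  obtains a n where "\<And>k. a k \<in> polyfun I" "\<exists>k\<le>n. \<exists>s\<in>cspace I. a k s \<noteq> 0"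
    "\<And>N. N \<in> X \<Longrightarrow> (\<Sum>k\<le>(n::nat). a k N * g N ^ k) = 0"
proof -
  obtain G b where G: "G \<in> polyfun J" "\<And>x. h x \<noteq> 0 \<Longrightarrow> g (\<iota> x) * h x ^ b = G x"
    using pullback[OF g] by blast
  obtain d1 where d1: "poly_deg I d1 h" using polyfun_poly_deg[OF h_poly finI] by blast
  obtain d2 where d2: "poly_deg I d2 G" using polyfun_poly_deg[OF G(1) finI] by blast
  have "\<forall>i\<in>I. \<exists>d. poly_deg I d (R i)" using polyfun_poly_deg[OF R_poly finI] IJ by blast
  then obtain d3 where d3: "\<And>i. i \<in> I \<Longrightarrow> poly_deg I (d3 i) (R i)" by metis
  define d where "d = d1 + d2 + (\<Sum>i\<in>I. d3 i)"
  have dh: "poly_deg I d h" using poly_deg_mono[OF finI d1] by (simp add: d_def)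
  have dG: "poly_deg I d G" using poly_deg_mono[OF finI d2] by (simp add: d_def)
  have dR: "poly_deg I d (R i)" if "i \<in> I" for i
  proof (rule poly_deg_mono[OF finI d3[OF that]])
    have "d3 i \<le> (\<Sum>i\<in>I. d3 i)" by (rule member_le_sum) (use that finI in auto)
    then show "d3 i \<le> d" by (simp add: d_def)
  qed
  \<comment> \<open>Bounds the degree per unit of n after clearing denominators:
    \<open>card I\<close> factors from the coordinates, 1 from \<open>G\<close>, and b from the
    power of h that accompanies g.\<close>
  define c where "c = (card I + b + 1) * d"
  \<comment> \<open>With k = \<open>card I\<close>, this choice gives \<open>(n * c + 1) ^ k \<le>
    (c + 1) ^ k * (n + 1) ^ k = n * (n + 1) ^ k < (n + 1) ^ (k + 1)\<close>.\<close>
  define n where "n = (c + 1) ^ card I"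
  define B where "B = expos I n \<times> {..n}"
  define C where "C = expos I (n * c)"
  have finB: "finite B" "finite C" by (auto simp: B_def C_def finI intro!: finite_PiE)
  \<comment> \<open>A monomial in the I-coordinates and g at \<open>\<iota> x\<close>, times a power
    of h that does not depend on the monomial. A linear relation among the \<open>P\<close> is
    therefore one among the monomials on \<open>Y\<close>.\<close>
  define P where "P = (\<lambda>(\<alpha>, k) x. (\<Prod>i\<in>I. R i x ^ \<alpha> i * h x ^ (n - \<alpha> i)) * (G x ^ k * h x ^ (b * (n - k))))"
  have P_deg: "poly_deg I (n * c) (P \<beta>)" if "\<beta> \<in> B" for \<beta>
  proof -
    obtain \<alpha> k where \<beta>: "\<beta> = (\<alpha>, k)" "\<alpha> \<in> expos I n" "k \<le> n" using \<open>\<beta> \<in> B\<close> by (auto simp: B_def)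
    have "poly_deg I (n * d) (\<lambda>x. R i x ^ \<alpha> i * h x ^ (n - \<alpha> i))" if "i \<in> I" for i
    proof -
      have "poly_deg I (\<alpha> i * d + (n - \<alpha> i) * d) (\<lambda>x. R i x ^ \<alpha> i * h x ^ (n - \<alpha> i))"
        by (intro poly_deg_mult poly_deg_power finI dR dh that)
      moreover have "\<alpha> i * d + (n - \<alpha> i) * d = n * d"
        using \<beta>(2) that by (simp add: PiE_iff add_mult_distrib[symmetric])
      ultimately show ?thesis by simp
    qed
    then have 1: "poly_deg I (card I * (n * d)) (\<lambda>x. \<Prod>i\<in>I. R i x ^ \<alpha> i * h x ^ (n - \<alpha> i))"
      by (intro poly_deg_prod finI)
    have "poly_deg I (k * d + (b * (n - k)) * d) (\<lambda>x. G x ^ k * h x ^ (b * (n - k)))"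
      by (intro poly_deg_mult poly_deg_power finI dG dh)
    moreover have "k * d + (b * (n - k)) * d \<le> n * d + (b * n) * d"
      using \<beta>(3) by (intro add_mono mult_right_mono mult_left_mono) auto
    ultimately have 2: "poly_deg I (n * d + (b * n) * d) (\<lambda>x. G x ^ k * h x ^ (b * (n - k)))"
      by (rule poly_deg_mono[OF finI])
    have "card I * (n * d) + (n * d + (b * n) * d) = n * c" by (simp add: c_def algebra_simps)
    then show ?thesis using poly_deg_mult[OF finI 1 2] by (simp add: P_def \<beta>(1))
  qed
  then have "\<forall>\<beta>\<in>B. \<exists>u. \<forall>x\<in>cspace I. P \<beta> x = (\<Sum>\<gamma>\<in>C. u \<gamma> * monom_fun I \<gamma> x)"
    unfolding poly_deg_def C_def by blast
  then obtain M where M: "\<And>\<beta> x. \<beta> \<in> B \<Longrightarrow> x \<in> cspace I \<Longrightarrow> P \<beta> x = (\<Sum>\<gamma>\<in>C. M \<beta> \<gamma> * monom_fun I \<gamma> x)"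
    unfolding bchoice_iff by blast
  have "card C < card B"
  proof -
    have "card C = (n * c + 1) ^ card I" by (simp add: C_def card_PiE finI)
    also have "\<dots> \<le> ((c + 1) * (n + 1)) ^ card I" by (intro power_mono) (auto simp: algebra_simps)
    also have "\<dots> = n * (n + 1) ^ card I" by (simp only: power_mult_distrib n_def)
    also have "\<dots> < (n + 1) ^ card I * (n + 1)" by simp
    also have "\<dots> = card B" by (simp add: B_def card_cartesian_product card_PiE finI)
    finally show ?thesis .
  qed
  then obtain u where u: "\<exists>\<beta>\<in>B. u \<beta> \<noteq> 0" "\<And>\<gamma>. \<gamma> \<in> C \<Longrightarrow> (\<Sum>\<beta>\<in>B. u \<beta> * M \<beta> \<gamma>) = 0"
    using underdetermined_system[OF finB(2,1)] by metis
  have uP: "(\<Sum>\<beta>\<in>B. u \<beta> * P \<beta> x) = 0" if x: "x \<in> cspace I" for x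
  proof -
    have "(\<Sum>\<beta>\<in>B. u \<beta> * P \<beta> x) = (\<Sum>\<beta>\<in>B. \<Sum>\<gamma>\<in>C. u \<beta> * M \<beta> \<gamma> * monom_fun I \<gamma> x)"
      using x by (intro sum.cong refl) (simp add: M sum_distrib_left mult.assoc)
    also have "\<dots> = (\<Sum>\<gamma>\<in>C. (\<Sum>\<beta>\<in>B. u \<beta> * M \<beta> \<gamma>) * monom_fun I \<gamma> x)"
      by (subst sum.swap) (simp add: sum_distrib_right)
    also have "\<dots> = 0" by (simp add: u(2))
    finally show ?thesis .
  qed
  define a where "a k s = (\<Sum>\<alpha>\<in>expos I n. u (\<alpha>, k) * monom_fun I \<alpha> s)" for k s
  have a_poly: "a k \<in> polyfun I" for k
    unfolding a_def[abs_def] by (intro polyfun_sum polyfun.mult polyfun.const monom_fun_polyfun)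
  obtain \<alpha> k where \<alpha>: "\<alpha> \<in> expos I n" "k \<le> n" "u (\<alpha>, k) \<noteq> 0" using u(1) by (auto simp: B_def)
  \<comment> \<open>Independence of the monomials turns one nonzero coefficient \<open>u\<close>
    into a nonzero polynomial \<open>a k\<close>.\<close>
  have a_nz: "\<exists>s\<in>cspace I. a k s \<noteq> 0"
    using monom_fun_independent[where n = n and u = "\<lambda>\<alpha>. u (\<alpha>, k)", OF finI] \<alpha> unfolding a_def by blast
  have Prel: "P (\<alpha>, k) x = monom_fun I \<alpha> (\<iota> x) * g (\<iota> x) ^ k * h x ^ (n * card I + b * n)"
    if x: "h x \<noteq> 0" and \<alpha>: "\<alpha> \<in> expos I n" "k \<le> n" for \<alpha> k x
  proof -
    have "R i x ^ \<alpha> i * h x ^ (n - \<alpha> i) = \<iota> x i ^ \<alpha> i * h x ^ n" if "i \<in> I" for i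
    proof -
      have "R i x = \<iota> x i * h x" using x that IJ by (auto simp: \<iota>_eq)
      moreover have "h x ^ \<alpha> i * h x ^ (n - \<alpha> i) = h x ^ n"
        using \<alpha>(1) that by (simp add: PiE_iff power_add[symmetric])
      ultimately show ?thesis by (simp add: power_mult_distrib mult.assoc)
    qed
    then have 1: "(\<Prod>i\<in>I. R i x ^ \<alpha> i * h x ^ (n - \<alpha> i)) = monom_fun I \<alpha> (\<iota> x) * h x ^ (n * card I)"
      by (simp add: monom_fun_def prod.distrib power_mult cong: prod.cong)
    have "G x ^ k * h x ^ (b * (n - k)) = g (\<iota> x) ^ k * (h x ^ (b * k) * h x ^ (b * (n - k)))"
      by (simp add: G(2)[OF x, symmetric] power_mult_distrib power_mult mult.assoc)
    also have "h x ^ (b * k) * h x ^ (b * (n - k)) = h x ^ (b * n)"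
      using \<alpha>(2) by (simp add: power_add[symmetric] distrib_left[symmetric])
    finally have 2: "G x ^ k * h x ^ (b * (n - k)) = g (\<iota> x) ^ k * h x ^ (b * n)" .
    show ?thesis unfolding P_def by (simp add: 1 2 power_add mult_ac)
  qed
  have "(\<Sum>k\<le>n. a k N * g N ^ k) = 0" if "N \<in> X" for N
  proof (rule X_poly[OF _ _ that])
    show "(\<lambda>N. \<Sum>k\<le>n. a k N * g N ^ k) \<in> polyfun J"
      by (intro polyfun_sum polyfun.mult polyfun_power g polyfun_mono[OF a_poly IJ])
    fix N assume "N \<in> Y"
    then obtain x where x: "x \<in> cspace I" "h x \<noteq> 0" "N = \<iota> x" unfolding Y_def by blast
    have "0 = (\<Sum>\<beta>\<in>B. u \<beta> * P \<beta> x)" using uP x(1) by simp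
    also have "\<dots> = (\<Sum>(\<alpha>,k)\<in>B. u (\<alpha>, k) * monom_fun I \<alpha> N * g N ^ k * h x ^ (n * card I + b * n))"
      by (rule sum.cong) (auto simp: B_def Prel x)
    also have "\<dots> = (\<Sum>\<alpha>\<in>expos I n. \<Sum>k\<le>n. u (\<alpha>, k) * monom_fun I \<alpha> N * g N ^ k * h x ^ (n * card I + b * n))"
      unfolding B_def by (rule sum.cartesian_product[symmetric])
    also have "\<dots> = (\<Sum>k\<le>n. a k N * g N ^ k) * h x ^ (n * card I + b * n)"
      by (subst sum.swap) (simp add: a_def sum_distrib_right)
    finally show "(\<Sum>k\<le>n. a k N * g N ^ k) = 0" using x(2) by simp
  qed
  then show thesis using that[of a n] a_poly a_nz \<alpha>(2) by blast
qed

section \<open>Consequences of the algebraic relations\<close>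

lemma polyfun_I_eq:
  assumes "a \<in> polyfun I" "\<And>i. i \<in> I \<Longrightarrow> N i = s i"
  shows "a N = a s"
  using polyfun_cong assms by blast

lemma zero_polyfun_I:
  assumes "a \<in> polyfun I" "\<And>s. s \<in> cspace I \<Longrightarrow> a s = 0"
  shows "a N = 0"
proof -
  have "a N = a (\<lambda>i. if i \<in> I then N i else 0)" using assms(1) by (rule polyfun_I_eq) auto
  then show ?thesis using assms(2) by (auto simp: cspace_def)
qed

text \<open>Divide a relation for g by the largest power of g that occurs in all its terms.
  Irreducibility shows that the cofactor \<open>q\<close> still vanishes on \<open>X\<close>, and
  where g = 0 it reduces to its constant coefficient \<open>a k0\<close>. So the zeros of g project
  into a proper hypersurface.\<close>

lemma zeros_not_dominant:
  assumes g: "g \<in> polyfun J" and N0: "N0 \<in> Y" "g N0 \<noteq> 0"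
  obtains a where "a \<in> polyfun I" "\<exists>s\<in>cspace I. a s \<noteq> 0" "\<And>N. N \<in> X \<Longrightarrow> g N = 0 \<Longrightarrow> a N = 0"
proof -
  obtain a n where a: "\<And>k. a k \<in> polyfun I" "\<exists>k\<le>n. \<exists>s\<in>cspace I. a k s \<noteq> 0"
    "\<And>N. N \<in> X \<Longrightarrow> (\<Sum>k\<le>(n::nat). a k N * g N ^ k) = 0"
    by (fact algebraic_relation[OF g])
  define k0 where "k0 = (LEAST k. \<exists>s\<in>cspace I. a k s \<noteq> 0)"
  have k0: "\<exists>s\<in>cspace I. a k0 s \<noteq> 0" unfolding k0_def by (rule LeastI_ex) (use a(2) in blast)
  obtain k1 where k1: "k1 \<le> n" "\<exists>s\<in>cspace I. a k1 s \<noteq> 0" using a(2) by blast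
  have "k0 \<le> k1" unfolding k0_def by (rule Least_le) (rule k1(2))
  then have "k0 \<le> n" using k1(1) by simp
  have low: "a k N = 0" if "k < k0" for k N
    using zero_polyfun_I[OF a(1)] not_less_Least[OF that[unfolded k0_def]] by blast
  define q where "q N = (\<Sum>k\<in>{k0..n}. a k N * g N ^ (k - k0))" for N
  have q_poly: "q \<in> polyfun J"
    unfolding q_def[abs_def]
    by (intro polyfun_sum polyfun.mult polyfun_power g polyfun_mono[OF a(1) IJ])
  have q0: "q N * g N ^ k0 = 0" if "N \<in> X" for N
  proof -
    have "(\<Sum>k\<le>n. a k N * g N ^ k) = (\<Sum>k\<in>{k0..n}. a k N * g N ^ k)"
      by (rule sum.mono_neutral_right) (auto simp: low not_le)
    also have "\<dots> = q N * g N ^ k0"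
      unfolding q_def sum_distrib_right
      by (rule sum.cong) (auto simp: power_add[symmetric] mult.assoc)
    finally show ?thesis using a(3)[OF that] by simp
  qed
  have "q N = 0" if "N \<in> Y" for N
    by (rule Y_irreducible[OF q_poly polyfun_power[OF g, of k0] _ N0(1) _ that]) (use q0 Y_X N0 in auto)
  then have qX: "q N = 0" if "N \<in> X" for N using X_poly[OF q_poly _ that] by blast
  have "a k0 N = 0" if "N \<in> X" "g N = 0" for N
  proof -
    have "q N = (\<Sum>k\<in>{k0..n}. if k = k0 then a k0 N else 0)"
      unfolding q_def by (rule sum.cong) (auto simp: that(2) power_0_left)
    then show ?thesis using qX[OF that(1)] \<open>k0 \<le> n\<close> by simp
  qed
  then show thesis using that[of "a k0"] a(1) k0 by blast
qed

text \<open>Truncation at the highest coefficient that is not identically 0; where this coefficient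
  is nonzero, the relation bounds g.\<close>

lemma integral_relation:
  assumes g: "g \<in> polyfun J"
  obtains a r where "\<And>k. a k \<in> polyfun I" "\<exists>s\<in>cspace I. a r s \<noteq> 0"
    "\<And>N. N \<in> X \<Longrightarrow> (\<Sum>k\<le>(r::nat). a k N * g N ^ k) = 0"
proof -
  obtain a n where a: "\<And>k. a k \<in> polyfun I" "\<exists>k\<le>n. \<exists>s\<in>cspace I. a k s \<noteq> 0"
    "\<And>N. N \<in> X \<Longrightarrow> (\<Sum>k\<le>(n::nat). a k N * g N ^ k) = 0"
    by (fact algebraic_relation[OF g])
  define r where "r = Max {k. k \<le> n \<and> (\<exists>s\<in>cspace I. a k s \<noteq> 0)}"
  have "r \<in> {k. k \<le> n \<and> (\<exists>s\<in>cspace I. a k s \<noteq> 0)}"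
    unfolding r_def by (rule Max_in) (use a(2) in auto)
  then have r: "r \<le> n" "\<exists>s\<in>cspace I. a r s \<noteq> 0" by auto
  have high: "a k N = 0" if "r < k" "k \<le> n" for k N
  proof (rule zero_polyfun_I[OF a(1)], rule ccontr)
    fix s assume "s \<in> cspace I" "a k s \<noteq> 0"
    then have "k \<le> r" unfolding r_def using that by (intro Max_ge) auto
    then show False using that by simp
  qed
  have "(\<Sum>k\<le>r. a k N * g N ^ k) = (\<Sum>k\<le>n. a k N * g N ^ k)" for N
    by (rule sum.mono_neutral_left) (use r high in auto)
  then show thesis using that[of a r] a r by auto
qed

section \<open>Local structure of the projection\<close>

lemma continuous_on_\<iota>: "continuous_on {x. h x \<noteq> 0} \<iota>"
proof (rule continuous_on_coordinatewise_then_product)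
  show "continuous_on {x. h x \<noteq> 0} (\<lambda>x. \<iota> x j)" for j
    unfolding \<iota>_eq
    by (cases "j \<in> J") (auto intro!: continuous_intros continuous_on_polyfun[OF R_poly] continuous_on_polyfun[OF h_poly])
qed

lemma open_h: "open {x. h x \<noteq> 0}"
  by (intro open_Collect_neq continuous_on_polyfun[OF h_poly] continuous_intros)

lemma closed_X: "closed X"
proof -
  have "X = cspace J \<inter> (\<Inter>p\<in>{p \<in> polyfun J. \<forall>N'\<in>Y. p N' = 0}. {N. p N = 0})"
    by (auto simp: X_def)
  also have "closed \<dots>"
    by (intro closed_Int closed_cspace closed_INT ballI closed_Collect_eq continuous_on_polyfun continuous_intros) auto
  finally show ?thesis .
qed

lemma jac_poly: "jac \<in> polyfun J"
  unfolding jac_def[abs_def]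
  by (rule poly_functions_comp_polyfun[OF det_on_poly[OF finI]]) (use \<tau>_poly IJ in blast)

text \<open>Near an invertible point, \<open>X\<close> is parametrised by \<open>cspace I\<close>
  through \<open>\<iota>\<close>. The projection becomes the I-coordinates of
  \<open>\<iota>\<close>, whose Jacobian matrix at \<open>\<iota> N0\<close> is inverted by its
  adjugate divided by \<open>jac N0\<close>.\<close>

lemma local_coordinates:
  assumes N0: "N0 \<in> X" "h N0 \<noteq> 0" "jac N0 \<noteq> 0" and U: "open U" "N0 \<in> U"
  obtains U' \<delta> where "open U'" "N0 \<in> U'" "U' \<subseteq> U" "\<delta> > 0"
    "\<And>N N'. N \<in> X \<inter> U' \<Longrightarrow> N' \<in> X \<inter> U' \<Longrightarrow> (\<And>i. i \<in> I \<Longrightarrow> N i = N' i) \<Longrightarrow> N = N'"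
    "\<And>s. (\<And>i. i \<in> I \<Longrightarrow> dist (s i) (N0 i) < \<delta>) \<Longrightarrow> \<exists>N \<in> X \<inter> U'. \<forall>i\<in>I. N i = s i"
proof -
  define x0 where "x0 = \<iota> N0"
  have x0: "x0 \<in> cspace I" "h x0 \<noteq> 0" "\<iota> x0 = N0"
    using X_\<iota> N0 h_\<iota> \<iota>_\<iota> X_cspace by (auto simp: x0_def)
  define A where "A = \<iota> -` U \<inter> {x. h x \<noteq> 0}"
  have "open A" unfolding A_def using continuous_on_\<iota> open_h U(1) by (simp add: continuous_on_open_vimage)
  have x0A: "x0 \<in> A" using x0 U by (simp add: A_def)
  define B where "B i k = adj_on I (\<tau> N0 N0) i k / jac N0" for i k
  have contA: "continuous_on A \<iota>" by (rule continuous_on_subset[OF continuous_on_\<iota>]) (simp add: A_def)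
  show thesis
  proof (rule local_inverse[OF finI \<open>open A\<close> x0A x0(1), where f = \<iota> and T = "\<lambda>x y. \<tau> (\<iota> x) (\<iota> y)" and B = B])
    show "continuous_on A (\<lambda>x. \<iota> x i)" for i
      using continuous_on_product_then_coordinatewise[OF contA] .
    show "\<iota> x i - \<iota> y i = (\<Sum>k\<in>I. \<tau> (\<iota> x) (\<iota> y) i k * (x k - y k))"
      if "x \<in> A \<inter> cspace I" "y \<in> A \<inter> cspace I" "i \<in> I" for x y i
    proof -
      have "\<iota> x i - \<iota> y i = (\<Sum>k\<in>J. \<tau> (\<iota> x) (\<iota> y) i k * (x k - y k))"
        using that IJ cspace_IJ by (intro \<iota>_diff) (auto simp: A_def)
      \<comment> \<open>Both parameters vanish outside I, so only a square block of the divided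
        differences remains.\<close>
      also have "\<dots> = (\<Sum>k\<in>I. \<tau> (\<iota> x) (\<iota> y) i k * (x k - y k))"
        using that by (intro sum.mono_neutral_right finJ IJ) (auto simp: cspaceD)
      finally show ?thesis .
    qed
    show "continuous_on (A \<times> A) (\<lambda>p. \<tau> (\<iota> (fst p)) (\<iota> (snd p)) i k)" if "i \<in> I" "k \<in> I" for i k
    proof -
      have "continuous_on (A \<times> A) (\<lambda>p. (\<iota> (fst p), \<iota> (snd p)))"
        by (intro continuous_on_Pair continuous_on_compose2[OF contA] continuous_intros) auto
      moreover have "continuous_on UNIV (\<lambda>p. \<tau> (fst p) (snd p) i k)" using \<tau>_cont that IJ by blast
      ultimately show ?thesis using continuous_on_compose2[of UNIV "\<lambda>p. \<tau> (fst p) (snd p) i k" "A \<times> A" "\<lambda>p. (\<iota> (fst p), \<iota> (snd p))"] by simp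
    qed
    show "(\<Sum>l\<in>I. B i l * \<tau> (\<iota> x0) (\<iota> x0) l k) = (if i = k then 1 else 0)" if "i \<in> I" "k \<in> I" for i k
      using adj_on_left[OF finI that, of "\<tau> N0 N0"] N0(3)
      by (simp add: x0 B_def sum_divide_distrib[symmetric] jac_def)
    show "(\<Sum>l\<in>I. \<tau> (\<iota> x0) (\<iota> x0) i l * B l k) = (if i = k then 1 else 0)" if "i \<in> I" "k \<in> I" for i k
      using adj_on_right[OF finI that, of "\<tau> N0 N0"] N0(3)
      by (simp add: x0 B_def sum_divide_distrib[symmetric] jac_def)
  next
    fix \<epsilon> \<delta> :: real
    assume \<epsilon>: "\<epsilon> > 0" and \<delta>: "\<delta> > 0"
      and sub: "{x \<in> cspace I. \<forall>i\<in>I. dist (x i) (x0 i) < \<epsilon>} \<subseteq> A"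
      and inj: "\<And>x y. x \<in> cspace I \<Longrightarrow> y \<in> cspace I \<Longrightarrow> (\<And>i. i \<in> I \<Longrightarrow> dist (x i) (x0 i) < \<epsilon>) \<Longrightarrow>
         (\<And>i. i \<in> I \<Longrightarrow> dist (y i) (x0 i) < \<epsilon>) \<Longrightarrow> (\<And>i. i \<in> I \<Longrightarrow> \<iota> x i = \<iota> y i) \<Longrightarrow> x = y"
      and surj: "\<And>s. (\<And>i. i \<in> I \<Longrightarrow> dist (s i) (\<iota> x0 i) < \<delta>) \<Longrightarrow>
         \<exists>x\<in>cspace I. (\<forall>i\<in>I. dist (x i) (x0 i) < \<epsilon>) \<and> (\<forall>i\<in>I. \<iota> x i = s i)"
    define V where "V = {N. \<forall>i\<in>I. dist (N i) (x0 i) < \<epsilon>}"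
    have "open V"
    proof -
      have "V = (\<Inter>i\<in>I. {N. dist (N i) (x0 i) < \<epsilon>})" by (auto simp: V_def)
      also have "open \<dots>" by (intro open_INT finI ballI open_Collect_less continuous_intros)
      finally show ?thesis .
    qed
    define U' where "U' = U \<inter> (\<iota> -` V \<inter> {x. h x \<noteq> 0})"
    have "open (\<iota> -` V \<inter> {x. h x \<noteq> 0})"
      using continuous_on_\<iota> open_h \<open>open V\<close> by (simp add: continuous_on_open_vimage)
    then have "open U'" unfolding U'_def by (rule open_Int[OF U(1)])
    moreover have "N0 \<in> U'" using U N0 \<epsilon> by (simp add: U'_def V_def x0_def)
    moreover have "N = N'" if "N \<in> X \<inter> U'" "N' \<in> X \<inter> U'" "\<And>i. i \<in> I \<Longrightarrow> N i = N' i" for N N'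
    proof -
      have U'D: "\<iota> N \<in> cspace I" "\<iota> (\<iota> N) = N" "\<And>i. i \<in> I \<Longrightarrow> dist (\<iota> N i) (x0 i) < \<epsilon>"
        if "N \<in> X \<inter> U'" for N
      proof -
        have "N \<in> X" "h N \<noteq> 0" "\<iota> N \<in> V" using that by (auto simp: U'_def)
        then show "\<iota> N \<in> cspace I" "\<iota> (\<iota> N) = N" "\<And>i. i \<in> I \<Longrightarrow> dist (\<iota> N i) (x0 i) < \<epsilon>"
          by (simp_all add: X_\<iota> \<iota>_\<iota> X_cspace V_def)
      qed
      note N = U'D[OF that(1)] and N' = U'D[OF that(2)]
      have "\<iota> N = \<iota> N'"
        by (rule inj[OF N(1) N'(1) N(3) N'(3)]) (simp_all add: N(2) N'(2) that(3))
      then show ?thesis using N(2) N'(2) by metis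
    qed
    moreover have "\<exists>N \<in> X \<inter> U'. \<forall>i\<in>I. N i = s i" if "\<And>i. i \<in> I \<Longrightarrow> dist (s i) (N0 i) < \<delta>" for s
    proof -
      have "\<exists>x\<in>cspace I. (\<forall>i\<in>I. dist (x i) (x0 i) < \<epsilon>) \<and> (\<forall>i\<in>I. \<iota> x i = s i)"
        using that x0(3) by (intro surj) auto
      then obtain x where x: "x \<in> cspace I" "\<forall>i\<in>I. dist (x i) (x0 i) < \<epsilon>" "\<forall>i\<in>I. \<iota> x i = s i"
        by blast
      have "x \<in> A" using x sub by blast
      then have hx: "h x \<noteq> 0" "\<iota> x \<in> U" by (auto simp: A_def)
      then have "\<iota> x \<in> X" using Y_X x(1) by (auto simp: Y_def)
      moreover have "\<iota> x \<in> U'" using hx x h_\<iota>[OF cspace_IJ[OF x(1)]] \<iota>_\<iota>[OF cspace_IJ[OF x(1)]]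
        by (auto simp: U'_def V_def)
      ultimately show ?thesis using x(3) by blast
    qed
    ultimately show thesis using that[of U' \<delta>] \<delta> by (auto simp: U'_def)
  qed
qed

text \<open>F may be a proper part of the fibre, as needed for a special fibre whose other points
  are not under control.\<close>

lemma isolating_neighbourhoods:
  assumes F: "finite F" "F \<subseteq> fibre s0" "\<forall>N\<in>F. h N \<noteq> 0 \<and> jac N \<noteq> 0"
  obtains U \<delta> where "\<And>N. N \<in> F \<Longrightarrow> open (U N)" "\<And>N. N \<in> F \<Longrightarrow> N \<in> U N" "disjoint_family_on U F" "\<delta> > 0"
    "\<And>s N. N \<in> F \<Longrightarrow> (\<And>i. i \<in> I \<Longrightarrow> dist (s i) (s0 i) < \<delta>) \<Longrightarrow> \<exists>N'. fibre s \<inter> U N = {N'}"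
proof -
  \<comment> \<open>In a coordinate where two points of F differ, their discs have radius half the
    distance, so the sets \<open>D\<close> are disjoint by the triangle inequality.\<close>
  define D where "D N = {M. \<forall>N'\<in>F. \<forall>j\<in>J. N j \<noteq> N' j \<longrightarrow> 2 * dist (M j) (N j) < dist (N j) (N' j)}" for N
  have D_open: "open (D N)" for N
  proof -
    have "D N = (\<Inter>N'\<in>F. \<Inter>j\<in>{j \<in> J. N j \<noteq> N' j}. {M. 2 * dist (M j) (N j) < dist (N j) (N' j)})"
      by (auto simp: D_def)
    also have "open \<dots>"
      using F(1) finJ by (intro open_INT ballI open_Collect_less continuous_intros) auto
    finally show ?thesis .
  qed
  have D_in: "N \<in> D N" for N by (auto simp: D_def)
  have D_disj: "D N \<inter> D N' = {}" if "N \<in> F" "N' \<in> F" "N \<noteq> N'" for N N'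
  proof (rule ccontr)
    assume "D N \<inter> D N' \<noteq> {}"
    then obtain M where M: "M \<in> D N" "M \<in> D N'" by blast
    have "N \<in> cspace J" "N' \<in> cspace J" using that F(2) X_cspace by (auto simp: fibre_def)
    then obtain j where j: "j \<in> J" "N j \<noteq> N' j" using \<open>N \<noteq> N'\<close> cspace_eqI[of N J N'] by blast
    have "2 * dist (M j) (N j) < dist (N j) (N' j)" using M(1) j \<open>N' \<in> F\<close> by (simp add: D_def)
    moreover have "2 * dist (M j) (N' j) < dist (N' j) (N j)" using M(2) j \<open>N \<in> F\<close> by (simp add: D_def)
    ultimately show False using dist_triangle2[of "N j" "N' j" "M j"] by (simp add: dist_commute)
  qed
  have "\<forall>N\<in>F. \<exists>U \<delta>. open U \<and> N \<in> U \<and> U \<subseteq> D N \<and> \<delta> > 0 \<and>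
    (\<forall>s. (\<forall>i\<in>I. dist (s i) (s0 i) < \<delta>) \<longrightarrow> (\<exists>N'. fibre s \<inter> U = {N'}))"
  proof
    fix N assume N: "N \<in> F"
    then have "N \<in> X" "h N \<noteq> 0" "jac N \<noteq> 0" and Ns: "\<And>i. i \<in> I \<Longrightarrow> N i = s0 i"
      using F by (auto simp: fibre_def)
    obtain U \<delta> where U: "open U" "N \<in> U" "U \<subseteq> D N" "\<delta> > 0"
      and inj: "\<And>M M'. M \<in> X \<inter> U \<Longrightarrow> M' \<in> X \<inter> U \<Longrightarrow> (\<And>i. i \<in> I \<Longrightarrow> M i = M' i) \<Longrightarrow> M = M'"
      and surj: "\<And>s. (\<And>i. i \<in> I \<Longrightarrow> dist (s i) (N i) < \<delta>) \<Longrightarrow> \<exists>M \<in> X \<inter> U. \<forall>i\<in>I. M i = s i"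
      by (fact local_coordinates[OF \<open>N \<in> X\<close> \<open>h N \<noteq> 0\<close> \<open>jac N \<noteq> 0\<close> D_open D_in])
    have "\<exists>N'. fibre s \<inter> U = {N'}" if s: "\<forall>i\<in>I. dist (s i) (s0 i) < \<delta>" for s
    proof -
      obtain M where M: "M \<in> X \<inter> U" "\<forall>i\<in>I. M i = s i" using surj[of s] s Ns by auto
      have "fibre s \<inter> U = {M}"
      proof (intro equalityI subsetI)
        fix M' assume "M' \<in> fibre s \<inter> U"
        then have "M' = M" using M by (intro inj) (auto simp: fibre_def)
        then show "M' \<in> {M}" by simp
      qed (use M in \<open>auto simp: fibre_def\<close>)
      then show ?thesis by blast
    qed
    then show "\<exists>U \<delta>. open U \<and> N \<in> U \<and> U \<subseteq> D N \<and> \<delta> > 0 \<and>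
      (\<forall>s. (\<forall>i\<in>I. dist (s i) (s0 i) < \<delta>) \<longrightarrow> (\<exists>N'. fibre s \<inter> U = {N'}))"
      using U by (intro exI[of _ U] exI[of _ \<delta>]) auto
  qed
  then obtain U where "\<forall>N\<in>F. \<exists>\<delta>. open (U N) \<and> N \<in> U N \<and> U N \<subseteq> D N \<and> \<delta> > 0 \<and>
    (\<forall>s. (\<forall>i\<in>I. dist (s i) (s0 i) < \<delta>) \<longrightarrow> (\<exists>N'. fibre s \<inter> U N = {N'}))"
    unfolding bchoice_iff by blast
  then obtain d where U: "\<And>N. N \<in> F \<Longrightarrow> open (U N) \<and> N \<in> U N \<and> U N \<subseteq> D N \<and> d N > 0"
    and Ud: "\<And>N s. N \<in> F \<Longrightarrow> \<forall>i\<in>I. dist (s i) (s0 i) < d N \<Longrightarrow> \<exists>N'. fibre s \<inter> U N = {N'}"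
    unfolding bchoice_iff by blast
  define \<delta> where "\<delta> = Min (insert 1 (d ` F))"
  have "\<delta> > 0" using F(1) U by (auto simp: \<delta>_def)
  have \<delta>d: "\<delta> \<le> d N" if "N \<in> F" for N using F(1) that by (auto simp: \<delta>_def)
  have "disjoint_family_on U F"
    unfolding disjoint_family_on_def using U D_disj by blast
  moreover have "\<exists>N'. fibre s \<inter> U N = {N'}" if "N \<in> F" "\<And>i. i \<in> I \<Longrightarrow> dist (s i) (s0 i) < \<delta>" for s N
    using that \<delta>d by (intro Ud) (auto intro: less_le_trans)
  ultimately show thesis using that[of U \<delta>] U \<open>\<delta> > 0\<close> by blast
qed

text \<open>Each point of F has a successor in its own neighbourhood, and further points only
  enlarge the fibre. Finiteness is assumed because the cardinality of an infinite set is 0.\<close>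

lemma card_fibre_ge:
  assumes F: "finite F" "F \<subseteq> fibre s0" "\<forall>N\<in>F. h N \<noteq> 0 \<and> jac N \<noteq> 0"
  obtains \<delta> where "\<delta> > 0"
    "\<And>s. (\<And>i. i \<in> I \<Longrightarrow> dist (s i) (s0 i) < \<delta>) \<Longrightarrow> finite (fibre s) \<Longrightarrow> card F \<le> card (fibre s)"
proof -
  obtain U \<delta> where U: "\<And>N. N \<in> F \<Longrightarrow> open (U N)" "\<And>N. N \<in> F \<Longrightarrow> N \<in> U N" "disjoint_family_on U F" "\<delta> > 0"
    "\<And>s N. N \<in> F \<Longrightarrow> (\<And>i. i \<in> I \<Longrightarrow> dist (s i) (s0 i) < \<delta>) \<Longrightarrow> \<exists>N'. fibre s \<inter> U N = {N'}"
    by (fact isolating_neighbourhoods[OF F])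
  have "card F \<le> card (fibre s)" if "\<And>i. i \<in> I \<Longrightarrow> dist (s i) (s0 i) < \<delta>" "finite (fibre s)" for s
  proof -
    have "\<forall>N\<in>F. \<exists>N'. fibre s \<inter> U N = {N'}" using U(5) that(1) by blast
    then obtain \<phi> where \<phi>: "\<And>N. N \<in> F \<Longrightarrow> fibre s \<inter> U N = {\<phi> N}" unfolding bchoice_iff by blast
    have "inj_on \<phi> F"
    proof (rule inj_onI, rule ccontr)
      fix N N' assume a: "N \<in> F" "N' \<in> F" "\<phi> N = \<phi> N'" "N \<noteq> N'"
      then have "U N \<inter> U N' = {}" using U(3) by (simp add: disjoint_family_on_def)
      moreover have "\<phi> N \<in> U N" "\<phi> N' \<in> U N'" using \<phi> a by blast+
      ultimately show False using a(3) by auto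
    qed
    moreover have "\<phi> ` F \<subseteq> fibre s" using \<phi> by blast
    ultimately show ?thesis using that(2) card_inj_on_le by blast
  qed
  then show thesis using that[of \<delta>] U(4) by blast
qed

section \<open>Generic fibres\<close>

lemma fibre_cong: "(\<And>i. i \<in> I \<Longrightarrow> s i = t i) \<Longrightarrow> fibre s = fibre t"
  by (auto simp: fibre_def)

text \<open>The hypersurface collects the images of the singular points and of the zeros of
  \<open>jac\<close>, and the leading coefficients of the relations for all coordinates in J. Off
  the latter, each coordinate of a fibre point is a root of a nonzero polynomial that depends only
  on s, which gives finiteness and local bounds.\<close>

lemma generic_fibre:
  obtains a where "a \<in> polyfun I" "\<exists>s\<in>cspace I. a s \<noteq> 0"
    "\<And>s. a s \<noteq> 0 \<Longrightarrow> finite (fibre s)"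
    "\<And>s N. a s \<noteq> 0 \<Longrightarrow> N \<in> fibre s \<Longrightarrow> h N \<noteq> 0 \<and> jac N \<noteq> 0"
    "\<And>s0. a s0 \<noteq> 0 \<Longrightarrow> \<exists>\<delta>>0. \<exists>b. \<forall>s. (\<forall>i\<in>I. dist (s i) (s0 i) < \<delta>) \<longrightarrow> (\<forall>N\<in>fibre s. \<forall>j\<in>J. norm (N j) \<le> b)"
proof -
  have e': "\<iota> e \<in> Y" "h (\<iota> e) \<noteq> 0" "jac (\<iota> e) \<noteq> 0"
    using e h_\<iota> cspace_IJ by (auto simp: Y_def jac_def)
  obtain a1 where a1: "a1 \<in> polyfun I" "\<exists>s\<in>cspace I. a1 s \<noteq> 0" "\<And>N. N \<in> X \<Longrightarrow> h N = 0 \<Longrightarrow> a1 N = 0"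
    by (fact zeros_not_dominant[OF h_poly e'(1,2)])
  obtain a2 where a2: "a2 \<in> polyfun I" "\<exists>s\<in>cspace I. a2 s \<noteq> 0" "\<And>N. N \<in> X \<Longrightarrow> jac N = 0 \<Longrightarrow> a2 N = 0"
    by (fact zeros_not_dominant[OF jac_poly e'(1,3)])
  have "\<forall>j\<in>J. \<exists>c. \<exists>r. (\<forall>k. c k \<in> polyfun I) \<and> (\<exists>s\<in>cspace I. c r s \<noteq> 0) \<and>
    (\<forall>N\<in>X. (\<Sum>k\<le>(r::nat). c k N * N j ^ k) = 0)"
  proof
    fix j assume "j \<in> J"
    obtain c r where "\<And>k. c k \<in> polyfun I" "\<exists>s\<in>cspace I. c r s \<noteq> 0"
      "\<And>N. N \<in> X \<Longrightarrow> (\<Sum>k\<le>(r::nat). c k N * N j ^ k) = 0"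
      by (fact integral_relation[OF polyfun.coord[OF \<open>j \<in> J\<close>]])
    then show "\<exists>c. \<exists>r. (\<forall>k. c k \<in> polyfun I) \<and> (\<exists>s\<in>cspace I. c r s \<noteq> 0) \<and>
      (\<forall>N\<in>X. (\<Sum>k\<le>(r::nat). c k N * N j ^ k) = 0)"
      by (intro exI[of _ c] exI[of _ r]) blast
  qed
  then obtain c where "\<forall>j\<in>J. \<exists>r. (\<forall>k. c j k \<in> polyfun I) \<and> (\<exists>s\<in>cspace I. c j r s \<noteq> 0) \<and>
    (\<forall>N\<in>X. (\<Sum>k\<le>(r::nat). c j k N * N j ^ k) = 0)"
    unfolding bchoice_iff by blast
  then obtain r where c: "\<And>j k. j \<in> J \<Longrightarrow> c j k \<in> polyfun I" "\<And>j. j \<in> J \<Longrightarrow> \<exists>s\<in>cspace I. c j (r j) s \<noteq> 0"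
    "\<And>j N. j \<in> J \<Longrightarrow> N \<in> X \<Longrightarrow> (\<Sum>k\<le>r j. c j k N * N j ^ k) = 0"
    unfolding bchoice_iff by blast
  \<comment> \<open>\<open>None\<close> stands for the determinant and the Jacobian,
    \<open>Some j\<close> for the leading coefficient at coordinate j.\<close>
  define f where "f = (\<lambda>x. case x of None \<Rightarrow> (\<lambda>s. a1 s * a2 s) | Some j \<Rightarrow> c j (r j))"
  define a where "a s = (\<Prod>x\<in>insert None (Some ` J). f x s)" for s
  have a_eq: "a s = a1 s * a2 s * (\<Prod>j\<in>J. c j (r j) s)" for s
    unfolding a_def f_def using finJ by (simp add: prod.reindex)
  have a12: "(\<lambda>s. a1 s * a2 s) \<in> polyfun I" by (rule polyfun.mult[OF a1(1) a2(1)])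
  obtain s t where st: "s \<in> cspace I" "a1 s \<noteq> 0" "t \<in> cspace I" "a2 t \<noteq> 0" using a1 a2 by blast
  obtain z where "a1 (line s t z) \<noteq> 0" "a2 (line s t z) \<noteq> 0"
    using polyfun_nonzero_near[OF a1(1) st(2) a2(1) st(4), of "{}" 1] by auto
  then have a12_nz: "\<exists>s\<in>cspace I. a1 s * a2 s \<noteq> 0"
    using line_in_cspace[OF st(1,3)] by (intro bexI[of _ "line s t z"]) auto
  have f_poly: "f x \<in> polyfun I" if "x \<in> insert None (Some ` J)" for x
    using that c(1) a12 by (auto simp: f_def)
  have a_poly: "a \<in> polyfun I"
    unfolding a_def[abs_def] using f_poly by (rule polyfun_prod)
  have a_nz: "\<exists>s\<in>cspace I. a s \<noteq> 0"
    unfolding a_def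
  proof (rule polyfun_prod_nonzero[OF _ f_poly])
    show "finite (insert None (Some ` J))" using finJ by simp
    show "\<exists>s\<in>cspace I. f x s \<noteq> 0" if "x \<in> insert None (Some ` J)" for x
      using that c(2) a12_nz by (auto simp: f_def)
  qed
  have cr: "c j (r j) s \<noteq> 0" if "a s \<noteq> 0" "j \<in> J" for s j
    using that finJ by (auto simp: a_eq)
  have rel: "(\<Sum>k\<le>r j. c j k s * N j ^ k) = 0" if "N \<in> fibre s" "j \<in> J" for N s j
  proof -
    have "c j k N = c j k s" for k
      by (rule polyfun_I_eq[OF c(1)[OF that(2)]]) (use that(1) in \<open>simp add: fibre_def\<close>)
    then show ?thesis using c(3)[OF that(2), of N] that(1) by (simp add: fibre_def)
  qed
  have fin: "finite (fibre s)" if "a s \<noteq> 0" for s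
  proof (rule finite_subset)
    define T where "T = (\<Union>j\<in>J. {t. (\<Sum>k\<le>r j. c j k s * t ^ k) = 0})"
    show "fibre s \<subseteq> {N. \<forall>j. (j \<in> J \<longrightarrow> N j \<in> T) \<and> (j \<notin> J \<longrightarrow> N j = 0)}"
      using rel by (auto simp: T_def fibre_def cspaceD[OF X_cspace])
    have "finite {t. (\<Sum>k\<le>r j. c j k s * t ^ k) = 0}" if "j \<in> J" for j
      by (rule finite_roots[where c = "\<lambda>k. c j k s" and r = "r j", OF cr[OF \<open>a s \<noteq> 0\<close> that]])
    then have "finite T" unfolding T_def by (intro finite_UN_I finJ)
    then show "finite {N. \<forall>j. (j \<in> J \<longrightarrow> N j \<in> T) \<and> (j \<notin> J \<longrightarrow> N j = 0)}"
      using finJ by (intro finite_set_of_finite_funs)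
  qed
  have good: "h N \<noteq> 0 \<and> jac N \<noteq> 0" if "a s \<noteq> 0" "N \<in> fibre s" for s N
  proof -
    have "N \<in> X" "a1 N = a1 s" "a2 N = a2 s"
      using that(2) polyfun_I_eq[OF a1(1), of N s] polyfun_I_eq[OF a2(1), of N s] by (auto simp: fibre_def)
    then show ?thesis using a1(3)[of N] a2(3)[of N] that(1) by (auto simp: a_eq)
  qed
  have bdd: "\<exists>\<delta>>0. \<exists>b. \<forall>s. (\<forall>i\<in>I. dist (s i) (s0 i) < \<delta>) \<longrightarrow> (\<forall>N\<in>fibre s. \<forall>j\<in>J. norm (N j) \<le> b)"
    if a0: "a s0 \<noteq> 0" for s0
  proof -
    define \<beta> where "\<beta> j s = 1 + (\<Sum>k<r j. norm (c j k s)) / norm (c j (r j) s)" for j s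
    have \<beta>0: "\<beta> j s \<ge> 0" for j s by (simp add: \<beta>_def sum_nonneg add_nonneg_nonneg)
    define A where "A = {s. a s \<noteq> 0}"
    have "open A" unfolding A_def
      by (intro open_Collect_neq continuous_on_polyfun[OF a_poly] continuous_intros)
    define W where "W j = \<beta> j -` {..<\<beta> j s0 + 1} \<inter> A" for j
    have "open (W j)" if "j \<in> J" for j
    proof -
      have "continuous_on A (\<beta> j)"
        unfolding \<beta>_def[abs_def] using cr that
        by (auto intro!: continuous_intros continuous_on_polyfun[OF c(1)] simp: A_def)
      then show ?thesis unfolding W_def using \<open>open A\<close> by (simp add: continuous_on_open_vimage)
    qed
    then have "open (A \<inter> (\<Inter>j\<in>J. W j))" using finJ \<open>open A\<close> by (intro open_Int open_INT) auto
    moreover have "s0 \<in> A \<inter> (\<Inter>j\<in>J. W j)" using a0 by (simp add: A_def W_def)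
    ultimately obtain \<delta> where \<delta>: "\<delta> > 0" "\<And>s. (\<And>i. i \<in> I \<Longrightarrow> dist (s i) (s0 i) < \<delta>) \<Longrightarrow>
        (\<And>i. i \<notin> I \<Longrightarrow> s i = s0 i) \<Longrightarrow> s \<in> A \<inter> (\<Inter>j\<in>J. W j)"
      using open_contains_box[OF _ _ finI] by metis
    have "norm (N j) \<le> (\<Sum>j\<in>J. \<beta> j s0 + 1)"
      if s: "\<forall>i\<in>I. dist (s i) (s0 i) < \<delta>" and N: "N \<in> fibre s" and j: "j \<in> J" for s N j
    proof -
      \<comment> \<open>The box around s0 freezes the coordinates outside I. Taking those from s0
        leaves the fibre unchanged.\<close>
      define t where "t i = (if i \<in> I then s i else s0 i)" for i
      have "t \<in> A \<inter> (\<Inter>j\<in>J. W j)" using s by (intro \<delta>(2)) (auto simp: t_def)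
      then have "t \<in> A" "t \<in> W j" using j by blast+
      then have t: "a t \<noteq> 0" "\<beta> j t \<le> \<beta> j s0 + 1" by (auto simp: A_def W_def)
      have "N \<in> fibre t" using N fibre_cong[of s t] by (simp add: t_def)
      then have "norm (N j) \<le> \<beta> j t"
        unfolding \<beta>_def
        by (intro root_bound[where c = "\<lambda>k. c j k t" and r = "r j", OF cr[OF t(1) j]] rel j)
      also have "\<dots> \<le> \<beta> j s0 + 1" by (rule t(2))
      also have "\<dots> \<le> (\<Sum>j\<in>J. \<beta> j s0 + 1)"
        by (rule member_le_sum) (use j finJ \<beta>0 in \<open>auto simp: add_nonneg_nonneg\<close>)
      finally show ?thesis .
    qed
    then show ?thesis using \<delta>(1) by blast
  qed
  show thesis by (rule that[OF a_poly a_nz fin good bdd])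
qed

text \<open>Each isolating neighbourhood contains one point of every nearby fibre. Points outside
  them all would lie in a compact set \<open>K\<close> disjoint from the fibre over s0, whose
  projection keeps a positive distance from s0.\<close>

lemma card_fibre_locally_const:
  assumes fin: "finite (fibre s0)" and good: "\<forall>N\<in>fibre s0. h N \<noteq> 0 \<and> jac N \<noteq> 0"
    and \<delta>2: "\<delta>2 > 0" and bdd: "\<forall>s. (\<forall>i\<in>I. dist (s i) (s0 i) < \<delta>2) \<longrightarrow> (\<forall>N\<in>fibre s. \<forall>j\<in>J. norm (N j) \<le> b)"
  obtains \<delta> where "\<delta> > 0" "\<And>s. \<forall>i\<in>I. dist (s i) (s0 i) < \<delta> \<Longrightarrow> card (fibre s) = card (fibre s0)"
proof -
  obtain U \<delta>1 where U: "\<And>N. N \<in> fibre s0 \<Longrightarrow> open (U N)" "\<And>N. N \<in> fibre s0 \<Longrightarrow> N \<in> U N"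
    "disjoint_family_on U (fibre s0)" "\<delta>1 > 0"
    "\<And>s N. N \<in> fibre s0 \<Longrightarrow> (\<And>i. i \<in> I \<Longrightarrow> dist (s i) (s0 i) < \<delta>1) \<Longrightarrow> \<exists>N'. fibre s \<inter> U N = {N'}"
    by (fact isolating_neighbourhoods[OF fin order_refl good])
  define K where "K = {N. \<forall>j. N j \<in> (if j \<in> J then cball 0 b else {0})} \<inter> (X \<inter> - (\<Union>N\<in>fibre s0. U N))"
  have "compact K"
    unfolding K_def using closed_X U(1)
    by (intro compact_Int_closed compact_product_sets closed_Int closed_Compl open_UN) auto
  define m where "m N = (\<Sum>i\<in>I. dist (N i) (s0 i))" for N
  have m_pos: "m N > 0" if "N \<in> K" for N
  proof (rule ccontr)
    assume "\<not> m N > 0"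
    then have "m N = 0" by (simp add: m_def sum_nonneg order_antisym)
    then have "N \<in> fibre s0" using that finI by (auto simp: m_def K_def fibre_def sum_nonneg_eq_0_iff)
    then show False using that U(2) by (auto simp: K_def)
  qed
  obtain m0 where m0: "m0 > 0" "\<And>N. N \<in> K \<Longrightarrow> m0 \<le> m N"
  proof (cases "K = {}")
    case True
    then show ?thesis using that[of 1] by simp
  next
    case False
    have "continuous_on K m" unfolding m_def[abs_def] by (intro continuous_intros)
    then obtain N0 where "N0 \<in> K" "\<forall>N\<in>K. m N0 \<le> m N"
      using continuous_attains_inf[OF \<open>compact K\<close> False] by blast
    then show ?thesis using that[of "m N0"] m_pos by blast
  qed
  \<comment> \<open>The last bound makes the sum of the distances over I smaller than
    \<open>m0\<close>, also if I is empty.\<close>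
  define \<delta> where "\<delta> = min (min \<delta>1 \<delta>2) (m0 / (card I + 1))"
  have "\<delta> > 0" using U(4) \<delta>2 m0 by (simp add: \<delta>_def)
  moreover have "card (fibre s) = card (fibre s0)" if s: "\<forall>i\<in>I. dist (s i) (s0 i) < \<delta>" for s
  proof -
    have s1: "\<And>i. i \<in> I \<Longrightarrow> dist (s i) (s0 i) < \<delta>1" and s2: "\<forall>i\<in>I. dist (s i) (s0 i) < \<delta>2"
      and s3: "\<And>i. i \<in> I \<Longrightarrow> dist (s i) (s0 i) \<le> m0 / (card I + 1)"
      using s by (auto simp: \<delta>_def)
    have "N \<in> (\<Union>N\<in>fibre s0. U N)" if N: "N \<in> fibre s" for N
    proof (rule ccontr)
      assume "N \<notin> (\<Union>N\<in>fibre s0. U N)"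
      then have "N \<in> K" using N bdd s2
        by (auto simp: K_def fibre_def cspaceD[OF X_cspace])
      then have "m0 \<le> m N" by (rule m0(2))
      also have "m N = (\<Sum>i\<in>I. dist (s i) (s0 i))"
        unfolding m_def by (rule sum.cong) (use N in \<open>auto simp: fibre_def\<close>)
      also have "\<dots> \<le> card I * (m0 / (card I + 1))"
        using s3 by (rule sum_bounded_above)
      also have "\<dots> < m0" using m0(1) by (simp add: field_simps)
      finally show False by simp
    qed
    then have eq: "fibre s = (\<Union>N\<in>fibre s0. fibre s \<inter> U N)" by blast
    have one: "card (fibre s \<inter> U N) = 1 \<and> finite (fibre s \<inter> U N)" if "N \<in> fibre s0" for N
      using U(5)[OF that s1] by auto
    have "card (fibre s) = (\<Sum>N\<in>fibre s0. card (fibre s \<inter> U N))"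
      by (subst eq, rule card_UN_disjoint) (use fin one U(3) in \<open>auto simp: disjoint_family_on_def\<close>)
    then show ?thesis using one by simp
  qed
  ultimately show thesis using that by blast
qed

lemma generic_card_fibre:
  obtains a d where "a \<in> polyfun I" "\<exists>s\<in>cspace I. a s \<noteq> 0"
    "\<And>s. a s \<noteq> 0 \<Longrightarrow> finite (fibre s) \<and> card (fibre s) = d"
    "\<And>s N. a s \<noteq> 0 \<Longrightarrow> N \<in> fibre s \<Longrightarrow> h N \<noteq> 0 \<and> jac N \<noteq> 0"
proof -
  obtain a where a: "a \<in> polyfun I" "\<exists>s\<in>cspace I. a s \<noteq> 0"
    and fin: "\<And>s. a s \<noteq> 0 \<Longrightarrow> finite (fibre s)"
    and good: "\<And>s N. a s \<noteq> 0 \<Longrightarrow> N \<in> fibre s \<Longrightarrow> h N \<noteq> 0 \<and> jac N \<noteq> 0"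
    and bdd: "\<And>s0. a s0 \<noteq> 0 \<Longrightarrow> \<exists>\<delta>>0. \<exists>b. \<forall>s. (\<forall>i\<in>I. dist (s i) (s0 i) < \<delta>) \<longrightarrow> (\<forall>N\<in>fibre s. \<forall>j\<in>J. norm (N j) \<le> b)"
    by (fact generic_fibre)
  have loc: "\<exists>\<delta>>0. \<forall>s. (\<forall>i\<in>I. dist (s i) (s0 i) < \<delta>) \<longrightarrow> card (fibre s) = card (fibre s0)" if a0: "a s0 \<noteq> 0" for s0
  proof -
    obtain \<delta>2 b where b: "\<delta>2 > 0" "\<forall>s. (\<forall>i\<in>I. dist (s i) (s0 i) < \<delta>2) \<longrightarrow> (\<forall>N\<in>fibre s. \<forall>j\<in>J. norm (N j) \<le> b)"
      using bdd[OF a0] by blast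
    have g: "\<forall>N\<in>fibre s0. h N \<noteq> 0 \<and> jac N \<noteq> 0" using good[OF a0] by blast
    obtain \<delta> where "\<delta> > 0" "\<And>s. \<forall>i\<in>I. dist (s i) (s0 i) < \<delta> \<Longrightarrow> card (fibre s) = card (fibre s0)"
      by (fact card_fibre_locally_const[OF fin[OF a0] g b])
    then show ?thesis by blast
  qed
  have eq: "card (fibre s0) = card (fibre s1)" if a0: "a s0 \<noteq> 0" and a1: "a s1 \<noteq> 0" for s0 s1
  proof -
    let ?B = "{z. a (line s0 s1 z) = 0}"
    have "finite ?B" using finite_zeros_on_line[OF a(1), of s0 s1 0] a0 by simp
    then have "Topological_Spaces.connected (- ?B)"
      by (intro path_connected_imp_connected path_connected_complement_countable) (auto intro: countable_finite)
    moreover have "0 \<in> - ?B" "1 \<in> - ?B" using a0 a1 by auto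
    moreover have "\<forall>z\<in>- ?B. \<forall>\<^sub>F w in at z within - ?B. card (fibre (line s0 s1 z)) = card (fibre (line s0 s1 w))"
    proof
      fix z assume "z \<in> - ?B"
      then obtain \<delta> where \<delta>: "\<delta> > 0" "\<And>s. \<forall>i\<in>I. dist (s i) (line s0 s1 z i) < \<delta> \<Longrightarrow> card (fibre s) = card (fibre (line s0 s1 z))"
        using loc[of "line s0 s1 z"] by auto
      have "\<forall>\<^sub>F w in at z within - ?B. dist (line s0 s1 w i) (line s0 s1 z i) < \<delta>" for i
      proof -
        have "((\<lambda>w. line s0 s1 w i) \<longlongrightarrow> line s0 s1 z i) (at z within - ?B)"
          unfolding line_def by (intro tendsto_intros)
        then show ?thesis using \<delta>(1) by (rule tendstoD)
      qed
      then have "\<forall>\<^sub>F w in at z within - ?B. \<forall>i\<in>I. dist (line s0 s1 w i) (line s0 s1 z i) < \<delta>"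
        using finI by (simp add: eventually_ball_finite)
      then show "\<forall>\<^sub>F w in at z within - ?B. card (fibre (line s0 s1 z)) = card (fibre (line s0 s1 w))"
        by eventually_elim (metis \<delta>(2))
    qed
    ultimately have "card (fibre (line s0 s1 0)) = card (fibre (line s0 s1 1))"
      by (rule connected_local_const)
    then show ?thesis by simp
  qed
  obtain s where s: "a s \<noteq> 0" using a(2) by blast
  show thesis
    by (rule that[OF a, of "card (fibre s)"]) (use fin good eq s in blast)+
qed

end

section \<open>Inversion of symmetric matrices\<close>

lemma mat_prod_assoc:
  "mat_prod V (mat_prod V A B) C = mat_prod V A (mat_prod V B C)"
proof (intro ext)
  fix i j
  have "mat_prod V (mat_prod V A B) C i j = (\<Sum>k\<in>V. \<Sum>l\<in>V. A i l * B l k * C k j)"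
    by (simp add: mat_prod_def sum_distrib_right)
  also have "\<dots> = (\<Sum>l\<in>V. \<Sum>k\<in>V. A i l * B l k * C k j)" by (rule sum.swap)
  also have "\<dots> = mat_prod V A (mat_prod V B C) i j"
    by (simp add: mat_prod_def sum_distrib_left mult.assoc)
  finally show "mat_prod V (mat_prod V A B) C i j = mat_prod V A (mat_prod V B C) i j" .
qed

lemma sym_matricesD:
  assumes "M \<in> sym_matrices V"
  shows "M i j = M j i" "i \<notin> V \<Longrightarrow> M i j = 0" "j \<notin> V \<Longrightarrow> M i j = 0"
  using assms by (auto simp: sym_matrices_def)

lemma mat_prod_id:
  assumes "finite V" "\<And>i j. i \<notin> V \<or> j \<notin> V \<Longrightarrow> M i j = 0"
  shows "mat_prod V M (mat_id V) = M" "mat_prod V (mat_id V) M = M"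
proof -
  show "mat_prod V M (mat_id V) = M"
  proof (intro ext)
    fix i j
    have "mat_prod V M (mat_id V) i j = (\<Sum>k\<in>V. if k = j then M i k else 0)"
      unfolding mat_prod_def mat_id_def by (rule sum.cong) auto
    then show "mat_prod V M (mat_id V) i j = M i j" using assms by simp
  qed
  show "mat_prod V (mat_id V) M = M"
  proof (intro ext)
    fix i j
    have "mat_prod V (mat_id V) M i j = (\<Sum>k\<in>V. if i = k then M k j else 0)"
      unfolding mat_prod_def mat_id_def by (rule sum.cong) auto
    then show "mat_prod V (mat_id V) M i j = M i j" using assms by simp
  qed
qed

lemma mat_inverses_unique:
  assumes "finite V" "mat_inverses V A B" "mat_inverses V A C"
    and "\<And>i j. i \<notin> V \<or> j \<notin> V \<Longrightarrow> B i j = 0" "\<And>i j. i \<notin> V \<or> j \<notin> V \<Longrightarrow> C i j = 0"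
  shows "B = C"
proof -
  have "B = mat_prod V B (mat_prod V A C)"
    using assms(3) mat_prod_id(1)[OF assms(1,4)] by (simp add: mat_inverses_def)
  also have "\<dots> = C"
    using assms(2) mat_prod_id(2)[OF assms(1,5)] by (simp add: mat_inverses_def mat_prod_assoc[symmetric])
  finally show ?thesis .
qed

lemma mat_inverses_det:
  assumes "finite V" "mat_inverses V A B"
  shows "det_on V A * det_on V B = 1"
proof (rule det_on_inverse[OF assms(1)])
  fix a b assume "a \<in> V" "b \<in> V"
  have "mat_prod V A B a b = mat_id V a b" using assms(2) by (simp add: mat_inverses_def)
  then show "(\<Sum>k\<in>V. A a k * B k b) = (if a = b then 1 else 0)"
    using \<open>a \<in> V\<close> by (simp add: mat_prod_def mat_id_def)
qed

definition mat_inv_on :: "'a set \<Rightarrow> ('a \<Rightarrow> 'a \<Rightarrow> complex) \<Rightarrow> 'a \<Rightarrow> 'a \<Rightarrow> complex" where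
  "mat_inv_on V M = (\<lambda>i j. if i \<in> V \<and> j \<in> V then adj_on V M i j / det_on V M else 0)"

lemma mat_inv_on_inverses:
  assumes "finite V" "M \<in> sym_matrices V" "det_on V M \<noteq> 0"
  shows "mat_inverses V M (mat_inv_on V M)"
  unfolding mat_inverses_def
proof (intro conjI ext)
  fix i j
  show "mat_prod V M (mat_inv_on V M) i j = mat_id V i j"
  proof (cases "i \<in> V \<and> j \<in> V")
    case True
    have "mat_prod V M (mat_inv_on V M) i j = (\<Sum>k\<in>V. M i k * adj_on V M k j) / det_on V M"
      using True by (simp add: mat_prod_def mat_inv_on_def sum_divide_distrib)
    also have "\<dots> = mat_id V i j"
      using True adj_on_right[OF assms(1), of i j M] assms(3) by (simp add: mat_id_def)
    finally show ?thesis .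
  next
    case False
    then show ?thesis using sym_matricesD(2,3)[OF assms(2)] by (auto simp: mat_prod_def mat_inv_on_def mat_id_def)
  qed
  show "mat_prod V (mat_inv_on V M) M i j = mat_id V i j"
  proof (cases "i \<in> V \<and> j \<in> V")
    case True
    have "mat_prod V (mat_inv_on V M) M i j = (\<Sum>k\<in>V. adj_on V M i k * M k j) / det_on V M"
      using True by (simp add: mat_prod_def mat_inv_on_def sum_divide_distrib)
    also have "\<dots> = mat_id V i j"
      using True adj_on_left[OF assms(1), of i j M] assms(3) by (simp add: mat_id_def)
    finally show ?thesis .
  next
    case False
    then show ?thesis using sym_matricesD(2,3)[OF assms(2)] by (auto simp: mat_prod_def mat_inv_on_def mat_id_def)
  qed
qed

text \<open>The transpose of the inverse is an inverse of the transpose, which is M again, and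
  inverses are unique.\<close>

lemma mat_inv_on_sym:
  assumes "finite V" "M \<in> sym_matrices V" "det_on V M \<noteq> 0"
  shows "mat_inv_on V M \<in> sym_matrices V"
proof -
  let ?N = "mat_inv_on V M"
  have M: "M i j = M j i" for i j using sym_matricesD(1)[OF assms(2)] .
  have inv: "mat_prod V M ?N = mat_id V" "mat_prod V ?N M = mat_id V"
    using mat_inv_on_inverses[OF assms] by (auto simp: mat_inverses_def)
  have "mat_prod V M (\<lambda>i j. ?N j i) i j = mat_prod V ?N M j i" for i j
    unfolding mat_prod_def by (rule sum.cong) (auto simp: M[of i])
  moreover have "mat_prod V (\<lambda>i j. ?N j i) M i j = mat_prod V M ?N j i" for i j
    unfolding mat_prod_def by (rule sum.cong) (auto simp: M[of j])
  ultimately have "mat_inverses V M (\<lambda>i j. ?N j i)"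
    unfolding mat_inverses_def inv by (auto simp: mat_id_def fun_eq_iff)
  then have "(\<lambda>i j. ?N j i) = ?N"
    by (rule mat_inverses_unique[OF assms(1) _ mat_inv_on_inverses[OF assms]]) (auto simp: mat_inv_on_def)
  then have "?N i j = ?N j i" for i j by metis
  then show ?thesis by (auto simp: sym_matrices_def mat_inv_on_def)
qed

lemma mat_inv_on_eq:
  assumes "finite V" "M \<in> sym_matrices V" "N \<in> sym_matrices V" "mat_inverses V M N"
  shows "det_on V M \<noteq> 0" "mat_inv_on V M = N"
proof -
  show "det_on V M \<noteq> 0" using mat_inverses_det[OF assms(1,4)] by auto
  then show "mat_inv_on V M = N"
    by (intro mat_inverses_unique[OF assms(1) mat_inv_on_inverses[OF assms(1,2)] assms(4)])
       (auto simp: mat_inv_on_def sym_matricesD[OF assms(3)])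
qed

lemma mat_inverses_commute: "mat_inverses V A B \<Longrightarrow> mat_inverses V B A"
  by (simp add: mat_inverses_def)

text \<open>A symmetric matrix is a function on the set of unordered pairs \<open>{i, j}\<close> with \<open>i = j\<close> allowed.\<close>

definition upairs :: "'a set \<Rightarrow> 'a set set" where
  "upairs V = {{i, j} | i j. i \<in> V \<and> j \<in> V}"

definition sym_mat :: "('a set \<Rightarrow> complex) \<Rightarrow> 'a \<Rightarrow> 'a \<Rightarrow> complex" where
  "sym_mat x = (\<lambda>i j. x {i, j})"

text \<open>An arbitrary order of the pair; a symmetric matrix does not depend on it.\<close>

definition rep :: "'a set \<Rightarrow> 'a \<times> 'a" where
  "rep c = (SOME p. c = {fst p, snd p})"

definition entries :: "'a set \<Rightarrow> ('a \<Rightarrow> 'a \<Rightarrow> complex) \<Rightarrow> 'a set \<Rightarrow> complex" where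
  "entries V M = (\<lambda>c. if c \<in> upairs V then M (fst (rep c)) (snd (rep c)) else 0)"

lemma upairs_iff [simp]: "{i, j} \<in> upairs V \<longleftrightarrow> i \<in> V \<and> j \<in> V"
  unfolding upairs_def by (auto simp: doubleton_eq_iff)

lemma upairs_singleton [simp]: "{i} \<in> upairs V \<longleftrightarrow> i \<in> V"
  using upairs_iff[of i i V] by simp

lemma finite_upairs: "finite V \<Longrightarrow> finite (upairs V)"
proof -
  assume "finite V"
  moreover have "upairs V = (\<lambda>(i, j). {i, j}) ` (V \<times> V)" by (auto simp: upairs_def)
  ultimately show ?thesis by simp
qed

lemma rep_pair: "{fst (rep {i, j}), snd (rep {i, j})} = {i, j}"
  unfolding rep_def by (rule someI2[of _ "(i, j)"]) auto

lemma rep_upairs: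
  assumes "c \<in> upairs V"
  shows "{fst (rep c), snd (rep c)} = c" "fst (rep c) \<in> V" "snd (rep c) \<in> V"
proof -
  obtain i j where c: "c = {i, j}" using assms by (auto simp: upairs_def)
  show eq: "{fst (rep c), snd (rep c)} = c" unfolding c by (rule rep_pair)
  then have "{fst (rep c), snd (rep c)} \<in> upairs V" using assms by simp
  then show "fst (rep c) \<in> V" "snd (rep c) \<in> V" by auto
qed

lemma sym_mat_in: "x \<in> cspace (upairs V) \<Longrightarrow> sym_mat x \<in> sym_matrices V"
  by (auto simp: sym_matrices_def sym_mat_def insert_commute cspaceD)

lemma entries_cspace: "entries V M \<in> cspace (upairs V)"
  by (simp add: entries_def cspace_def)

lemma entries_sym_mat: "x \<in> cspace (upairs V) \<Longrightarrow> entries V (sym_mat x) = x"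
  by (auto simp: entries_def sym_mat_def rep_upairs cspaceD)

lemma sym_mat_entries:
  assumes "M \<in> sym_matrices V"
  shows "sym_mat (entries V M) = M"
proof (intro ext)
  fix i j :: 'a
  have "{fst (rep {i, j}), snd (rep {i, j})} = {i, j}" by (rule rep_pair)
  then have "M (fst (rep {i, j})) (snd (rep {i, j})) = M i j"
    using sym_matricesD(1)[OF assms, of i j] by (auto simp: doubleton_eq_iff)
  then show "sym_mat (entries V M) i j = M i j"
    by (auto simp: sym_mat_def entries_def sym_matricesD(2,3)[OF assms])
qed

lemma sym_matrices_eq: "sym_matrices V = sym_mat ` cspace (upairs V)"
proof (intro equalityI subsetI)
  fix M assume "M \<in> sym_matrices V"
  then show "M \<in> sym_mat ` cspace (upairs V)"
    by (intro image_eqI[of _ _ "entries V M"]) (simp_all add: sym_mat_entries entries_cspace)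
qed (auto simp: sym_mat_in)

lemma inj_sym_mat: "inj_on sym_mat (cspace (upairs V))"
  by (rule inj_on_inverseI[of _ "entries V"]) (rule entries_sym_mat)

lemma poly_functions_sym_mat: "p \<in> poly_functions V \<Longrightarrow> (\<lambda>x. p (sym_mat x)) \<in> polyfun (upairs V)"
  by (erule poly_functions_comp_polyfun[where f = sym_mat]) (simp add: sym_mat_def polyfun.coord)

lemma polyfun_entries: "p \<in> polyfun (upairs V) \<Longrightarrow> (\<lambda>M. p (entries V M)) \<in> poly_functions V"
  by (erule polyfun_comp_poly_functions[where f = "entries V"]) (simp add: entries_def rep_upairs poly_functions.entry)

definition pair_inv :: "'a set \<Rightarrow> ('a set \<Rightarrow> complex) \<Rightarrow> 'a set \<Rightarrow> complex" where
  "pair_inv V x = (\<lambda>c. if c \<in> upairs V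
     then adj_on V (sym_mat x) (fst (rep c)) (snd (rep c)) / det_on V (sym_mat x) else 0)"

text \<open>The coefficients of the divided difference \<open>A - B = A (B\<^sup>-\<^sup>1 - A\<^sup>-\<^sup>1) B\<close> of the inversion.\<close>

definition pair_diff :: "'a set \<Rightarrow> ('a set \<Rightarrow> complex) \<Rightarrow> ('a set \<Rightarrow> complex) \<Rightarrow> 'a set \<Rightarrow> 'a set \<Rightarrow> complex" where
  "pair_diff V N N' c d =
     - (\<Sum>(k, l)\<in>{p \<in> V \<times> V. {fst p, snd p} = d}. N {fst (rep c), k} * N' {l, snd (rep c)})"

definition pair_id :: "'a set \<Rightarrow> 'a set \<Rightarrow> complex" where
  "pair_id V = (\<lambda>c. if \<exists>v\<in>V. c = {v} then 1 else 0)"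

lemma sym_mat_pair_id: "sym_mat (pair_id V) = mat_id V"
  by (auto simp: sym_mat_def pair_id_def mat_id_def fun_eq_iff)

lemma pair_id_cspace: "(\<And>v. v \<in> V \<Longrightarrow> {v} \<in> I) \<Longrightarrow> pair_id V \<in> cspace I"
  by (auto simp: pair_id_def cspace_def)

lemma pair_inv_entries: "pair_inv V x = entries V (mat_inv_on V (sym_mat x))"
  by (auto simp: pair_inv_def entries_def mat_inv_on_def rep_upairs)

lemma sym_mat_pair_inv:
  assumes "finite V" "x \<in> cspace (upairs V)" "det_on V (sym_mat x) \<noteq> 0"
  shows "sym_mat (pair_inv V x) = mat_inv_on V (sym_mat x)"
  unfolding pair_inv_entries by (intro sym_mat_entries mat_inv_on_sym sym_mat_in assms)

lemma pair_inv_inverses: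
  assumes "finite V" "x \<in> cspace (upairs V)" "det_on V (sym_mat x) \<noteq> 0"
  shows "mat_inverses V (sym_mat x) (sym_mat (pair_inv V x))"
  unfolding sym_mat_pair_inv[OF assms] by (intro mat_inv_on_inverses sym_mat_in assms)

lemma pair_inv_eq:
  assumes "finite V" "x \<in> cspace (upairs V)" "y \<in> cspace (upairs V)" "mat_inverses V (sym_mat x) (sym_mat y)"
  shows "det_on V (sym_mat x) \<noteq> 0" "pair_inv V x = y"
proof -
  note * = mat_inv_on_eq[OF assms(1) sym_mat_in[OF assms(2)] sym_mat_in[OF assms(3)] assms(4)]
  show "det_on V (sym_mat x) \<noteq> 0" by (rule *(1))
  show "pair_inv V x = y" unfolding pair_inv_entries *(2) by (rule entries_sym_mat[OF assms(3)])
qed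

lemma pair_inv_diff:
  assumes V: "finite V" and x: "x \<in> cspace (upairs V)" "det_on V (sym_mat x) \<noteq> 0"
    and y: "y \<in> cspace (upairs V)" "det_on V (sym_mat y) \<noteq> 0" and c: "c \<in> upairs V"
  shows "pair_inv V x c - pair_inv V y c =
    (\<Sum>d\<in>upairs V. pair_diff V (pair_inv V x) (pair_inv V y) c d * (x d - y d))"
proof -
  define i j where "i = fst (rep c)" and "j = snd (rep c)"
  have c_eq: "{i, j} = c" using rep_upairs[OF c] by (simp add: i_def j_def)
  define A where "A = sym_mat (pair_inv V x)"
  define B where "B = sym_mat (pair_inv V y)"
  have A: "A \<in> sym_matrices V" and B: "B \<in> sym_matrices V"
    unfolding A_def B_def by (intro sym_mat_in; simp add: pair_inv_entries entries_cspace)+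
  have AX: "mat_prod V A (sym_mat x) = mat_id V" and YB: "mat_prod V (sym_mat y) B = mat_id V"
    using pair_inv_inverses[OF V x] pair_inv_inverses[OF V y] by (auto simp: A_def B_def mat_inverses_def)
  have "A = mat_prod V A (mat_prod V (sym_mat y) B)"
    unfolding YB using sym_matricesD(2,3)[OF A] by (subst mat_prod_id[OF V]) auto
  moreover have "B = mat_prod V A (mat_prod V (sym_mat x) B)"
    unfolding mat_prod_assoc[symmetric] AX using sym_matricesD(2,3)[OF B] by (subst mat_prod_id[OF V]) auto
  ultimately have "A i j - B i j = mat_prod V A (mat_prod V (sym_mat y) B) i j - mat_prod V A (mat_prod V (sym_mat x) B) i j"
    by metis
  also have "\<dots> = (\<Sum>k\<in>V. \<Sum>l\<in>V. A i k * B l j * (y {k, l} - x {k, l}))"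
    by (simp add: mat_prod_def sym_mat_def sum_distrib_left sum_subtractf[symmetric] algebra_simps)
  also have "\<dots> = (\<Sum>(k, l)\<in>V \<times> V. A i k * B l j * (y {k, l} - x {k, l}))"
    by (rule sum.cartesian_product)
  \<comment> \<open>Grouping by unordered pairs collects two ordered pairs off the diagonal and one
    on it.\<close>
  also have "\<dots> = (\<Sum>d\<in>upairs V. \<Sum>(k, l)\<in>{p \<in> V \<times> V. {fst p, snd p} = d}. A i k * B l j * (y {k, l} - x {k, l}))"
    by (rule sum.group[symmetric]) (use V finite_upairs in auto)
  also have "\<dots> = (\<Sum>d\<in>upairs V. pair_diff V (pair_inv V x) (pair_inv V y) c d * (x d - y d))"
  proof (rule sum.cong[OF refl])
    fix d
    have "(\<Sum>(k, l)\<in>{p \<in> V \<times> V. {fst p, snd p} = d}. A i k * B l j * (y {k, l} - x {k, l}))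
      = (\<Sum>(k, l)\<in>{p \<in> V \<times> V. {fst p, snd p} = d}. A i k * B l j * (y d - x d))"
      by (rule sum.cong) auto
    also have "\<dots> = (\<Sum>(k, l)\<in>{p \<in> V \<times> V. {fst p, snd p} = d}. A i k * B l j) * (y d - x d)"
      by (simp add: sum_distrib_right case_prod_unfold)
    also have "\<dots> = - (\<Sum>(k, l)\<in>{p \<in> V \<times> V. {fst p, snd p} = d}. A i k * B l j) * (x d - y d)"
      by (simp add: algebra_simps)
    finally show "(\<Sum>(k, l)\<in>{p \<in> V \<times> V. {fst p, snd p} = d}. A i k * B l j * (y {k, l} - x {k, l}))
      = pair_diff V (pair_inv V x) (pair_inv V y) c d * (x d - y d)"
      by (simp add: pair_diff_def A_def B_def sym_mat_def i_def j_def)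
  qed
  finally show ?thesis by (simp add: A_def B_def sym_mat_def c_eq)
qed

text \<open>The derivative of inversion at the identity matrix is minus the identity. It stays
  invertible when restricted to any set of coordinates.\<close>

lemma pair_diff_id:
  assumes V: "finite V" and c: "c \<in> upairs V"
  shows "pair_diff V (pair_id V) (pair_id V) c d = (if c = d then - 1 else 0)"
proof -
  define i j where "i = fst (rep c)" and "j = snd (rep c)"
  have ij: "{i, j} = c" "i \<in> V" "j \<in> V" using rep_upairs[OF c] by (auto simp: i_def j_def)
  let ?S = "{p \<in> V \<times> V. {fst p, snd p} = d}"
  have "pair_diff V (pair_id V) (pair_id V) c d = - (\<Sum>p\<in>?S. if p = (i, j) then 1 else 0)"
    unfolding pair_diff_def i_def[symmetric] j_def[symmetric] case_prod_unfold
    by (intro arg_cong[where f = uminus] sum.cong) (auto simp: pair_id_def prod_eq_iff)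
  also have "(\<Sum>p\<in>?S. if p = (i, j) then 1 else 0 :: complex) = (if (i, j) \<in> ?S then 1 else 0)"
    using V by (subst sum.delta) auto
  also have "(i, j) \<in> ?S \<longleftrightarrow> c = d" using ij by auto
  finally show ?thesis by simp
qed

lemma pair_inv_id:
  assumes "finite V"
  shows "det_on V (sym_mat (pair_id V)) \<noteq> 0" "pair_inv V (pair_id V) = pair_id V"
proof -
  have id: "pair_id V \<in> cspace (upairs V)" by (rule pair_id_cspace) simp
  have "mat_prod V (mat_id V) (mat_id V) = mat_id V"
    by (rule mat_prod_id[OF assms]) (auto simp: mat_id_def)
  then have "mat_inverses V (sym_mat (pair_id V)) (sym_mat (pair_id V))"
    by (simp add: mat_inverses_def sym_mat_pair_id)
  then show "det_on V (sym_mat (pair_id V)) \<noteq> 0" "pair_inv V (pair_id V) = pair_id V"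
    using pair_inv_eq[OF assms id id] by blast+
qed

text \<open>The diagonal belongs to I so that the identity matrix can serve as the point where the
  Jacobian is nonzero.\<close>

lemma rational_involution_pair_inv:
  assumes V: "finite V" and I: "I \<subseteq> upairs V" "\<And>v. v \<in> V \<Longrightarrow> {v} \<in> I"
  shows "rational_involution (upairs V) I (\<lambda>x. det_on V (sym_mat x))
    (\<lambda>c x. adj_on V (sym_mat x) (fst (rep c)) (snd (rep c))) (pair_diff V) (pair_inv V) (pair_id V)"
proof
  show "finite (upairs V)" by (rule finite_upairs[OF V])
  show "I \<subseteq> upairs V" by fact
  show "(\<lambda>x. det_on V (sym_mat x)) \<in> polyfun (upairs V)"
    by (rule poly_functions_sym_mat[OF det_on_poly[OF V]])
  show "(\<lambda>x. adj_on V (sym_mat x) (fst (rep c)) (snd (rep c))) \<in> polyfun (upairs V)" if "c \<in> upairs V" for c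
    using rep_upairs[OF that] by (intro poly_functions_sym_mat[OF adj_on_poly[OF V]])
  show "pair_inv V x = (\<lambda>j. if j \<in> upairs V then adj_on V (sym_mat x) (fst (rep j)) (snd (rep j)) / det_on V (sym_mat x) else 0)" for x
    by (simp add: pair_inv_def)
  have inv: "det_on V (sym_mat (pair_inv V x)) \<noteq> 0 \<and> pair_inv V (pair_inv V x) = x"
    if "x \<in> cspace (upairs V)" "det_on V (sym_mat x) \<noteq> 0" for x
    using pair_inv_eq[OF V _ that(1) mat_inverses_commute[OF pair_inv_inverses[OF V that]]]
    by (simp add: pair_inv_entries entries_cspace)
  then show "det_on V (sym_mat (pair_inv V x)) \<noteq> 0" "pair_inv V (pair_inv V x) = x"
    if "x \<in> cspace (upairs V)" "det_on V (sym_mat x) \<noteq> 0" for x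
    using that by blast+
  show "pair_inv V x j - pair_inv V y j = (\<Sum>k\<in>upairs V. pair_diff V (pair_inv V x) (pair_inv V y) j k * (x k - y k))"
    if "x \<in> cspace (upairs V)" "y \<in> cspace (upairs V)" "det_on V (sym_mat x) \<noteq> 0" "det_on V (sym_mat y) \<noteq> 0" "j \<in> upairs V" for x y j
    by (rule pair_inv_diff[OF V that(1,3,2,4,5)])
  show "continuous_on S (\<lambda>p. pair_diff V (fst p) (snd p) j k)" for S j k
    unfolding pair_diff_def case_prod_unfold
    by (intro continuous_intros continuous_on_product_then_coordinatewise[OF continuous_on_fst[OF continuous_on_id]]
        continuous_on_product_then_coordinatewise[OF continuous_on_snd[OF continuous_on_id]])
  show "(\<lambda>N. pair_diff V N N j k) \<in> polyfun (upairs V)" if "j \<in> upairs V" for j k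
    unfolding pair_diff_def case_prod_unfold using rep_upairs[OF that]
    by (intro polyfun_uminus polyfun_sum polyfun.mult polyfun.coord) auto
  show "pair_id V \<in> cspace I" by (rule pair_id_cspace[OF I(2)])
  show "det_on V (sym_mat (pair_id V)) \<noteq> 0" by (rule pair_inv_id[OF V])
  have finI: "finite I" using I(1) finite_upairs[OF V] finite_subset by blast
  let ?T = "pair_diff V (pair_id V) (pair_id V)"
  \<comment> \<open>On I, \<open>?T\<close> is minus the identity and thus its own inverse, so its
    determinant is a unit.\<close>
  have "(\<Sum>k\<in>I. ?T a k * ?T k b) = (if a = b then 1 else 0)" if "a \<in> I" "b \<in> I" for a b
  proof -
    have "(\<Sum>k\<in>I. ?T a k * ?T k b) = (\<Sum>k\<in>I. if a = k then (if a = b then 1 else 0) else 0)"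
      by (rule sum.cong) (use that I(1) in \<open>auto simp: pair_diff_id[OF V] subset_iff\<close>)
    then show ?thesis using that finI by simp
  qed
  then have "det_on I ?T * det_on I ?T = 1" by (rule det_on_inverse[OF finI])
  then show "det_on I (pair_diff V (pair_inv V (pair_id V)) (pair_inv V (pair_id V))) \<noteq> 0"
    unfolding pair_inv_id(2)[OF V] by auto
qed

section \<open>The ML-degree of a graph\<close>

text \<open>Two generic values of the fibre cardinality are attained at a common matrix; this gives
  the uniqueness behind \<open>ml_degree\<close>.\<close>

lemma generically_conj:
  assumes "generically V P" "generically V Q"
  shows "\<exists>S\<in>sym_matrices V. P S \<and> Q S"
proof -
  obtain p where p: "p \<in> poly_functions V" "\<exists>S\<in>sym_matrices V. p S \<noteq> 0" "\<And>S. S \<in> sym_matrices V \<Longrightarrow> p S \<noteq> 0 \<Longrightarrow> P S"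
    using assms(1) unfolding generically_def by blast
  obtain q where q: "q \<in> poly_functions V" "\<exists>S\<in>sym_matrices V. q S \<noteq> 0" "\<And>S. S \<in> sym_matrices V \<Longrightarrow> q S \<noteq> 0 \<Longrightarrow> Q S"
    using assms(2) unfolding generically_def by blast
  obtain x where x: "x \<in> cspace (upairs V)" "p (sym_mat x) \<noteq> 0" using p(2) unfolding sym_matrices_eq by blast
  obtain y where y: "y \<in> cspace (upairs V)" "q (sym_mat y) \<noteq> 0" using q(2) unfolding sym_matrices_eq by blast
  obtain z where z: "p (sym_mat (line x y z)) \<noteq> 0" "q (sym_mat (line x y z)) \<noteq> 0"
    using polyfun_nonzero_near[where p = "\<lambda>x. p (sym_mat x)" and q = "\<lambda>x. q (sym_mat x)",
        OF poly_functions_sym_mat[OF p(1)] x(2) poly_functions_sym_mat[OF q(1)] y(2), of "{}" 1]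
    by auto
  have "sym_mat (line x y z) \<in> sym_matrices V" using line_in_cspace[OF x(1) y(1)] by (rule sym_mat_in)
  then show ?thesis using p(3) q(3) z by blast
qed

lemma generically_sym_mat:
  assumes "a \<in> polyfun (upairs V)" "s0 \<in> cspace (upairs V)" "a s0 \<noteq> 0"
    "\<And>s. s \<in> cspace (upairs V) \<Longrightarrow> a s \<noteq> 0 \<Longrightarrow> P (sym_mat s)"
  shows "generically V P"
  unfolding generically_def
proof (intro bexI conjI ballI impI)
  show "(\<lambda>M. a (entries V M)) \<in> poly_functions V" by (rule polyfun_entries[OF assms(1)])
  show "a (entries V (sym_mat s0)) \<noteq> 0" using assms(2,3) by (simp add: entries_sym_mat)
  show "sym_mat s0 \<in> sym_matrices V" by (rule sym_mat_in[OF assms(2)])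
  fix S assume S: "S \<in> sym_matrices V" "a (entries V S) \<noteq> 0"
  then have "P (sym_mat (entries V S))" using assms(4) entries_cspace by blast
  then show "P S" using S(1) by (simp add: sym_mat_entries)
qed

definition edge_pairs :: "'a pair_pre_digraph \<Rightarrow> 'a set set" where
  "edge_pairs G = {{i, j} | i j. i \<in> pverts G \<and> j \<in> pverts G \<and> (i = j \<or> (i, j) \<in> parcs G)}"

text \<open>Both properties pass to an induced subgraph at once, so the locale serves G and H
  alike.\<close>

locale finite_sym_graph =
  fixes G :: "'a pair_pre_digraph"
  assumes finite_verts: "finite (pverts G)" and sym_arcs: "\<And>i j. (i, j) \<in> parcs G \<Longrightarrow> (j, i) \<in> parcs G"
begin

abbreviation "V \<equiv> pverts G"

lemma edge_pairs_iff [simp]: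
  "{i, j} \<in> edge_pairs G \<longleftrightarrow> i \<in> V \<and> j \<in> V \<and> (i = j \<or> (i, j) \<in> parcs G)"
  using sym_arcs by (auto simp: edge_pairs_def doubleton_eq_iff)

lemma edge_pairs_upairs: "edge_pairs G \<subseteq> upairs V"
  by (auto simp: edge_pairs_def)

lemma singleton_edge_pairs: "v \<in> V \<Longrightarrow> {v} \<in> edge_pairs G"
  using edge_pairs_iff[of v v] by simp

sublocale rational_involution "upairs V" "edge_pairs G" "\<lambda>x. det_on V (sym_mat x)"
  "\<lambda>c x. adj_on V (sym_mat x) (fst (rep c)) (snd (rep c))" "pair_diff V" "pair_inv V" "pair_id V"
  by (rule rational_involution_pair_inv[OF finite_verts edge_pairs_upairs singleton_edge_pairs])

lemma graph_space_eq: "graph_space G = sym_mat ` cspace (edge_pairs G)"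
proof (intro equalityI subsetI)
  fix M assume M: "M \<in> graph_space G"
  then have sym: "M \<in> sym_matrices V" by (simp add: graph_space_def)
  have "entries V M c = 0" if "c \<notin> edge_pairs G" for c
  proof (cases "c \<in> upairs V")
    case True
    then have "{fst (rep c), snd (rep c)} \<notin> edge_pairs G" using that rep_upairs(1)[OF True] by simp
    then have "fst (rep c) \<noteq> snd (rep c) \<and> (fst (rep c), snd (rep c)) \<notin> parcs G"
      using rep_upairs(2,3)[OF True] by simp
    then show ?thesis using M True by (simp add: graph_space_def entries_def)
  qed (simp add: entries_def)
  then have "entries V M \<in> cspace (edge_pairs G)" by (simp add: cspace_def)
  then show "M \<in> sym_mat ` cspace (edge_pairs G)"
    using sym_mat_entries[OF sym] by (metis imageI)
next
  fix M assume "M \<in> sym_mat ` cspace (edge_pairs G)"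
  then obtain x where x: "x \<in> cspace (edge_pairs G)" "M = sym_mat x" by blast
  then show "M \<in> graph_space G"
    using sym_mat_in[OF cspace_IJ[OF x(1)]] by (auto simp: graph_space_def sym_mat_def cspaceD[OF x(1)])
qed

lemma inverses_eq: "{N \<in> sym_matrices V. \<exists>M\<in>graph_space G. mat_inverses V M N} = sym_mat ` Y"
proof (intro equalityI subsetI)
  fix N assume "N \<in> {N \<in> sym_matrices V. \<exists>M\<in>graph_space G. mat_inverses V M N}"
  then obtain x y where x: "x \<in> cspace (edge_pairs G)" and y: "y \<in> cspace (upairs V)" "N = sym_mat y"
    and inv: "mat_inverses V (sym_mat x) (sym_mat y)"
    unfolding graph_space_eq sym_matrices_eq by blast
  have "det_on V (sym_mat x) \<noteq> 0" "pair_inv V x = y"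
    by (rule pair_inv_eq[OF finite_verts cspace_IJ[OF x] y(1) inv])+
  then show "N \<in> sym_mat ` Y" using x y(2) by (auto simp: Y_def)
next
  fix N assume "N \<in> sym_mat ` Y"
  then obtain x where x: "x \<in> cspace (edge_pairs G)" "det_on V (sym_mat x) \<noteq> 0" "N = sym_mat (pair_inv V x)"
    unfolding Y_def by blast
  have "mat_inverses V (sym_mat x) N" unfolding x(3) by (rule pair_inv_inverses[OF finite_verts cspace_IJ[OF x(1)] x(2)])
  moreover have "N \<in> sym_matrices V" unfolding x(3) by (rule sym_mat_in[OF \<iota>_cspace])
  ultimately show "N \<in> {N \<in> sym_matrices V. \<exists>M\<in>graph_space G. mat_inverses V M N}"
    using x(1) by (auto simp: graph_space_eq)
qed

lemma graph_space_inv_eq: "graph_space_inv G = sym_mat ` X"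
  unfolding graph_space_inv_def inverses_eq
proof (intro equalityI subsetI)
  fix M assume M: "M \<in> zariski_closure V (sym_mat ` Y)"
  then obtain x where x: "x \<in> cspace (upairs V)" "M = sym_mat x"
    unfolding zariski_closure_def sym_matrices_eq by blast
  have "p x = 0" if p: "p \<in> polyfun (upairs V)" "\<And>N. N \<in> Y \<Longrightarrow> p N = 0" for p
  proof -
    have "\<forall>N\<in>sym_mat ` Y. p (entries V N) = 0"
      using p(2) Y_X X_cspace by (auto simp: entries_sym_mat subset_iff)
    moreover have "\<forall>q\<in>poly_functions V. (\<forall>N\<in>sym_mat ` Y. q N = 0) \<longrightarrow> q M = 0"
      using M unfolding zariski_closure_def by (rule CollectE) (rule conjunct2)
    note bspec[OF this polyfun_entries[OF p(1)]]
    ultimately have "p (entries V M) = 0" by (rule rev_mp)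
    then show ?thesis using x by (simp add: entries_sym_mat)
  qed
  then have "x \<in> X" using x(1) by (simp add: X_def)
  then show "M \<in> sym_mat ` X" using x(2) by blast
next
  fix M assume "M \<in> sym_mat ` X"
  then obtain x where x: "x \<in> X" "M = sym_mat x" by blast
  have "p M = 0" if p: "p \<in> poly_functions V" "\<forall>N\<in>sym_mat ` Y. p N = 0" for p
    unfolding x(2) by (rule X_poly[OF poly_functions_sym_mat[OF p(1)] _ x(1)]) (use p(2) in blast)
  then show "M \<in> zariski_closure V (sym_mat ` Y)"
    using sym_mat_in[OF X_cspace[OF x(1)]] x(2) by (simp add: zariski_closure_def)
qed

lemma trace_sym_mat:
  "mat_trace V (mat_prod V (sym_mat x) (sym_mat n)) = (\<Sum>p\<in>V \<times> V. x {fst p, snd p} * n {fst p, snd p})"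
proof -
  have "mat_trace V (mat_prod V (sym_mat x) (sym_mat n)) = (\<Sum>i\<in>V. \<Sum>k\<in>V. x {i, k} * n {i, k})"
    unfolding mat_trace_def mat_prod_def sym_mat_def by (simp add: insert_commute)
  also have "\<dots> = (\<Sum>(i, k)\<in>V \<times> V. x {i, k} * n {i, k})" by (rule sum.cartesian_product)
  finally show ?thesis by (simp add: case_prod_unfold)
qed

lemma graph_space_perp_eq:
  "graph_space_perp G = sym_mat ` {n \<in> cspace (upairs V). \<forall>c\<in>edge_pairs G. n c = 0}"
proof (intro equalityI subsetI)
  fix N assume N: "N \<in> graph_space_perp G"
  then obtain n where n: "n \<in> cspace (upairs V)" "N = sym_mat n"
    unfolding graph_space_perp_def sym_matrices_eq by blast
  have "n c = 0" if c: "c \<in> edge_pairs G" for c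
  proof -
    \<comment> \<open>The test matrix supported on the single pair c.\<close>
    define x :: "'a set \<Rightarrow> complex" where "x d = (if d = c then 1 else 0)" for d
    have "x \<in> cspace (edge_pairs G)" using c by (auto simp: x_def cspace_def)
    then have "mat_trace V (mat_prod V (sym_mat x) (sym_mat n)) = 0"
      using N n(2) by (auto simp: graph_space_perp_def graph_space_eq)
    then have "0 = (\<Sum>p\<in>V \<times> V. x {fst p, snd p} * n {fst p, snd p})" by (simp add: trace_sym_mat)
    \<comment> \<open>The trace form counts c once for each of its orderings, a nonzero number of
      times.\<close>
    also have "\<dots> = (\<Sum>p\<in>{p \<in> V \<times> V. {fst p, snd p} = c}. n c)"
      using finite_verts by (intro sum.mono_neutral_cong_right) (auto simp: x_def)
    finally have "of_nat (card {p \<in> V \<times> V. {fst p, snd p} = c}) * n c = 0" by simp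
    moreover have "rep c \<in> {p \<in> V \<times> V. {fst p, snd p} = c}"
      using rep_upairs[of c V] c edge_pairs_upairs by (auto simp: mem_Times_iff)
    then have "card {p \<in> V \<times> V. {fst p, snd p} = c} \<noteq> 0"
      using finite_verts by (metis (no_types, lifting) card_0_eq empty_iff finite_SigmaI finite_subset mem_Collect_eq subsetI)
    ultimately show ?thesis by simp
  qed
  then show "N \<in> sym_mat ` {n \<in> cspace (upairs V). \<forall>c\<in>edge_pairs G. n c = 0}" using n by blast
next
  fix N assume "N \<in> sym_mat ` {n \<in> cspace (upairs V). \<forall>c\<in>edge_pairs G. n c = 0}"
  then obtain n where n: "n \<in> cspace (upairs V)" "\<And>c. c \<in> edge_pairs G \<Longrightarrow> n c = 0" "N = sym_mat n" by blast
  have "mat_trace V (mat_prod V (sym_mat x) (sym_mat n)) = 0" if "x \<in> cspace (edge_pairs G)" for x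
    unfolding trace_sym_mat by (rule sum.neutral) (metis n(2) cspaceD[OF that] mult_eq_0_iff)
  then show "N \<in> graph_space_perp G"
    using sym_mat_in[OF n(1)] n(3) by (auto simp: graph_space_perp_def graph_space_eq)
qed

text \<open>Adding \<open>graph_space_perp G\<close> frees exactly the entries at non-edges, so the
  affine slice prescribes the coordinates in \<open>edge_pairs G\<close>.\<close>

lemma ml_fibre_eq:
  assumes s: "s \<in> cspace (upairs V)"
  shows "ml_fibre G (sym_mat s) = sym_mat ` fibre s"
proof (intro equalityI subsetI)
  fix M assume "M \<in> ml_fibre G (sym_mat s)"
  then obtain y n where y: "y \<in> X" "M = sym_mat y" and n: "\<And>c. c \<in> edge_pairs G \<Longrightarrow> n c = 0"
    and eq: "M = (\<lambda>i j. sym_mat s i j + sym_mat n i j)"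
    unfolding ml_fibre_def graph_space_inv_eq graph_space_perp_eq by blast
  have "y c = s c" if c: "c \<in> edge_pairs G" for c
  proof -
    have "{fst (rep c), snd (rep c)} = c" using rep_upairs c edge_pairs_upairs by blast
    moreover have "sym_mat y (fst (rep c)) (snd (rep c)) = sym_mat s (fst (rep c)) (snd (rep c)) + sym_mat n (fst (rep c)) (snd (rep c))"
      using y(2) eq by metis
    ultimately show ?thesis using n[OF c] by (simp add: sym_mat_def)
  qed
  then show "M \<in> sym_mat ` fibre s" using y by (auto simp: fibre_def)
next
  fix M assume "M \<in> sym_mat ` fibre s"
  then obtain y where y: "y \<in> X" "\<And>c. c \<in> edge_pairs G \<Longrightarrow> y c = s c" "M = sym_mat y"
    by (auto simp: fibre_def)
  define n where "n c = y c - s c" for c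
  have "n \<in> cspace (upairs V)" using s X_cspace[OF y(1)] by (simp add: n_def cspace_def)
  then have "sym_mat n \<in> graph_space_perp G" using y(2) by (auto simp: graph_space_perp_eq n_def)
  moreover have "M = (\<lambda>i j. sym_mat s i j + sym_mat n i j)" by (simp add: y(3) sym_mat_def n_def)
  ultimately show "M \<in> ml_fibre G (sym_mat s)"
    using y(1,3) unfolding ml_fibre_def graph_space_inv_eq by blast
qed

lemma card_fibre_ml_degree:
  obtains a where "a \<in> polyfun (edge_pairs G)" "\<exists>s\<in>cspace (edge_pairs G). a s \<noteq> 0"
    "\<And>s. a s \<noteq> 0 \<Longrightarrow> finite (fibre s) \<and> card (fibre s) = ml_degree G"
    "\<And>s N. a s \<noteq> 0 \<Longrightarrow> N \<in> fibre s \<Longrightarrow> det_on V (sym_mat N) \<noteq> 0 \<and> jac N \<noteq> 0"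
proof -
  obtain a d where a: "a \<in> polyfun (edge_pairs G)" "\<exists>s\<in>cspace (edge_pairs G). a s \<noteq> 0"
    and d: "\<And>s. a s \<noteq> 0 \<Longrightarrow> finite (fibre s) \<and> card (fibre s) = d"
    and good: "\<And>s N. a s \<noteq> 0 \<Longrightarrow> N \<in> fibre s \<Longrightarrow> det_on V (sym_mat N) \<noteq> 0 \<and> jac N \<noteq> 0"
    by (fact generic_card_fibre)
  obtain s0 where s0: "s0 \<in> cspace (edge_pairs G)" "a s0 \<noteq> 0" using a(2) by blast
  let ?P = "\<lambda>d S. finite (ml_fibre G S) \<and> card (ml_fibre G S) = d"
  have gen: "generically V (?P d)"
  proof (rule generically_sym_mat[OF polyfun_mono[OF a(1) edge_pairs_upairs] cspace_IJ[OF s0(1)] s0(2)])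
    fix s assume s: "s \<in> cspace (upairs V)" "a s \<noteq> 0"
    have "inj_on sym_mat (fibre s)"
      by (rule inj_on_subset[OF inj_sym_mat[of V]]) (auto simp: fibre_def X_cspace)
    then show "?P d (sym_mat s)"
      unfolding ml_fibre_eq[OF s(1)] using d[OF s(2)] by (simp add: card_image)
  qed
  have "ml_degree G = d"
    unfolding ml_degree_def
  proof (rule the_equality)
    fix d' assume "generically V (?P d')"
    then show "d' = d" using generically_conj[OF gen] by blast
  qed (rule gen)
  then show thesis using that[OF a] d good by blast
qed

end

theorem corollary2p2:
  fixes G H :: "'a pair_pre_digraph"
  assumes "pair_graph G"
    and "induced_subgraph (with_proj H) (with_proj G)"
  shows "ml_degree G \<ge> ml_degree H"
proof -
  interpret pg: pair_graph G by fact
  have WV: "pverts H \<subseteq> pverts G" and arcsH: "parcs H = {e \<in> parcs G. fst e \<in> pverts H \<and> snd e \<in> pverts H}"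
    using assms(2) by (auto simp: induced_subgraph_def subgraph_def)
  interpret g: finite_sym_graph G
    by unfold_locales (auto intro: pg.arcs_symmetric)
  interpret h: finite_sym_graph H
    using finite_subset[OF WV g.finite_verts] by unfold_locales (auto simp: arcsH intro: pg.arcs_symmetric)
  let ?V = "pverts G" and ?W = "pverts H"
  have edges_sub: "edge_pairs H \<subseteq> edge_pairs G"
    using WV by (auto simp: edge_pairs_def arcsH)
  \<comment> \<open>Inducedness enters here: every edge of G inside \<open>?W\<close> is prescribed
    in the fibres of H, so the extensions of all points of one fibre agree on the edges of
    G.\<close>
  have edges_induced: "c \<in> edge_pairs H" if "c \<in> edge_pairs G" "c \<in> upairs ?W" for c
    using that by (auto simp: upairs_def arcsH)
  have upairs_sub: "upairs ?W \<subseteq> upairs ?V"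
    using WV by (auto simp: upairs_def)

  \<comment> \<open>In matrix terms, the block sum with the identity on the vertices outside
    \<open>?W\<close>.\<close>
  define ext where "ext x = (\<lambda>c. if c \<in> upairs ?W then x c else pair_id ?V c)" for x :: "'a set \<Rightarrow> complex"
  have ext_cspace: "ext x \<in> cspace (edge_pairs G)" if x: "x \<in> cspace (edge_pairs H)" for x
  proof -
    have "ext x c = 0" if "c \<notin> edge_pairs G" for c
      using that edges_sub cspaceD[OF x, of c] cspaceD[OF g.e(1), of c] by (auto simp: ext_def)
    then show ?thesis by (simp add: cspace_def)
  qed
  have ext_cspace': "ext x \<in> cspace (upairs ?V)" for x
    using upairs_sub cspaceD[OF g.cspace_IJ[OF g.e(1)]] by (auto simp: ext_def cspace_def)
  have ext_inj: "inj_on ext (cspace (upairs ?W))"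
  proof (rule inj_onI)
    fix x y assume "x \<in> cspace (upairs ?W)" "y \<in> cspace (upairs ?W)" "ext x = ext y"
    then show "x = y" by (intro cspace_eqI[of x "upairs ?W" y]) (auto simp: ext_def dest: fun_cong split: if_splits)
  qed
  have ext_entry: "sym_mat (ext x) i j = (if i \<in> ?W \<and> j \<in> ?W then x {i, j} else mat_id ?V i j)" for x i j
    using sym_mat_pair_id[of ?V, THEN fun_cong, THEN fun_cong, of i j] by (auto simp: sym_mat_def ext_def)
  have ext_prod: "mat_prod ?V (sym_mat (ext x)) (sym_mat (ext y)) = mat_id ?V"
    if xy: "mat_prod ?W (sym_mat x) (sym_mat y) = mat_id ?W" for x y
  proof (intro ext)
    fix i j
    show "mat_prod ?V (sym_mat (ext x)) (sym_mat (ext y)) i j = mat_id ?V i j"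
    proof (cases "i \<in> ?W")
      case True
      \<comment> \<open>A row indexed by \<open>?W\<close> has no entries outside \<open>?W\<close>,
        so the product is computed in the block.\<close>
      have "mat_prod ?V (sym_mat (ext x)) (sym_mat (ext y)) i j = (\<Sum>k\<in>?W. x {i, k} * sym_mat (ext y) k j)"
        unfolding mat_prod_def
        by (rule sum.mono_neutral_cong_right[OF g.finite_verts WV]) (use True in \<open>auto simp: ext_entry mat_id_def\<close>)
      also have "\<dots> = mat_id ?V i j"
      proof (cases "j \<in> ?W")
        case j: True
        have "(\<Sum>k\<in>?W. x {i, k} * sym_mat (ext y) k j) = mat_prod ?W (sym_mat x) (sym_mat y) i j"
          unfolding mat_prod_def by (rule sum.cong[OF refl], subst ext_entry) (simp add: True j sym_mat_def)
        then show ?thesis using True j WV by (auto simp: xy mat_id_def)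
      next
        case j: False
        have "(\<Sum>k\<in>?W. x {i, k} * sym_mat (ext y) k j) = 0"
          by (rule sum.neutral) (use j in \<open>auto simp: ext_entry mat_id_def\<close>)
        then show ?thesis using True j by (auto simp: mat_id_def)
      qed
      finally show ?thesis .
    next
      case False
      have "mat_prod ?V (sym_mat (ext x)) (sym_mat (ext y)) i j = (\<Sum>k\<in>?V. if i = k then mat_id ?V i j else 0)"
        unfolding mat_prod_def by (rule sum.cong) (use False in \<open>auto simp: ext_entry mat_id_def\<close>)
      also have "\<dots> = mat_id ?V i j" using g.finite_verts by (simp add: mat_id_def)
      finally show ?thesis .
    qed
  qed
  have ext_inverses: "mat_inverses ?V (sym_mat (ext x)) (sym_mat (ext y))"
    if "mat_inverses ?W (sym_mat x) (sym_mat y)" for x y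
    using that ext_prod by (simp add: mat_inverses_def)

  have jac_poly: "(\<lambda>x. g.jac (ext x)) \<in> polyfun (upairs ?W)"
  proof (rule polyfun_comp[OF g.jac_poly])
    show "(\<lambda>x. ext x c) \<in> polyfun (upairs ?W)" for c
      by (cases "c \<in> upairs ?W") (auto simp: ext_def intro: polyfun.intros)
  qed
  have "ext (pair_id ?W) = pair_id ?V"
    using WV by (auto simp: ext_def pair_id_def fun_eq_iff)
  then have jac_id: "g.jac (ext (pair_id ?W)) \<noteq> 0"
    using g.e(3) unfolding pair_inv_id(2)[OF g.finite_verts] by (simp add: g.jac_def)
  have "pair_id ?W \<in> h.Y"
    using h.e pair_inv_id[OF h.finite_verts] unfolding h.Y_def by (metis (mono_tags, lifting) mem_Collect_eq)
  \<comment> \<open>The Jacobian of G is a polynomial on the closure for H through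
    \<open>ext\<close> and is nonzero at the identity, so its zeros lie over a proper hypersurface
    of the data of H.\<close>
  then obtain a' where a': "a' \<in> polyfun (edge_pairs H)" "\<exists>s\<in>cspace (edge_pairs H). a' s \<noteq> 0"
    "\<And>N. N \<in> h.X \<Longrightarrow> g.jac (ext N) = 0 \<Longrightarrow> a' N = 0"
    using h.zeros_not_dominant[OF jac_poly _ jac_id] by blast
  obtain aH where aH: "aH \<in> polyfun (edge_pairs H)" "\<exists>s\<in>cspace (edge_pairs H). aH s \<noteq> 0"
    "\<And>s. aH s \<noteq> 0 \<Longrightarrow> finite (h.fibre s) \<and> card (h.fibre s) = ml_degree H"
    "\<And>s N. aH s \<noteq> 0 \<Longrightarrow> N \<in> h.fibre s \<Longrightarrow> det_on ?W (sym_mat N) \<noteq> 0 \<and> h.jac N \<noteq> 0"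
    by (fact h.card_fibre_ml_degree)
  obtain aG where aG: "aG \<in> polyfun (edge_pairs G)" "\<exists>s\<in>cspace (edge_pairs G). aG s \<noteq> 0"
    "\<And>s. aG s \<noteq> 0 \<Longrightarrow> finite (g.fibre s) \<and> card (g.fibre s) = ml_degree G"
    "\<And>s N. aG s \<noteq> 0 \<Longrightarrow> N \<in> g.fibre s \<Longrightarrow> det_on ?V (sym_mat N) \<noteq> 0 \<and> g.jac N \<noteq> 0"
    by (fact g.card_fibre_ml_degree)
  obtain s1 s2 where s12: "aH s1 \<noteq> 0" "a' s2 \<noteq> 0" using aH(2) a'(2) by blast
  obtain z where z: "aH (line s1 s2 z) \<noteq> 0" "a' (line s1 s2 z) \<noteq> 0"
    using polyfun_nonzero_near[OF aH(1) s12(1) a'(1) s12(2), of "{}" 1] by auto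
  define s where "s = line s1 s2 z"
  define F where "F = ext ` h.fibre s"
  have fibre_s: "finite (h.fibre s)" "card (h.fibre s) = ml_degree H"
    using aH(3)[of s] z by (auto simp: s_def)
  have "card F = ml_degree H"
    unfolding F_def fibre_s(2)[symmetric]
    by (intro card_image inj_on_subset[OF ext_inj]) (auto simp: h.fibre_def h.X_cspace)
  have F_good: "N \<in> g.fibre (ext s) \<and> det_on ?V (sym_mat N) \<noteq> 0 \<and> g.jac N \<noteq> 0" if "N \<in> F" for N
  proof -
    obtain M where M: "M \<in> h.X" "\<And>c. c \<in> edge_pairs H \<Longrightarrow> M c = s c" "M \<in> h.fibre s" "N = ext M"
      using \<open>N \<in> F\<close> by (auto simp: F_def h.fibre_def)
    have det: "det_on ?W (sym_mat M) \<noteq> 0" using aH(4)[of s M] z M(3) by (auto simp: s_def)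
    \<comment> \<open>The inverse of M lies in the graph space of H, so its block sum with 1 lies in
      that of G and has inverse N. Thus N is an actual inverse and not merely a limit point.\<close>
    define x where "x = pair_inv ?W M"
    have x: "x \<in> cspace (edge_pairs H)" unfolding x_def by (rule h.X_\<iota>[OF M(1) det])
    have "mat_inverses ?W (sym_mat x) (sym_mat M)"
      unfolding x_def by (rule mat_inverses_commute[OF pair_inv_inverses[OF h.finite_verts h.X_cspace[OF M(1)] det]])
    then have inv: "mat_inverses ?V (sym_mat (ext x)) (sym_mat N)"
      unfolding M(4) by (rule ext_inverses)
    have "det_on ?V (sym_mat (ext x)) \<noteq> 0" "pair_inv ?V (ext x) = N"
      using pair_inv_eq[OF g.finite_verts ext_cspace' _ inv] ext_cspace' by (auto simp: M(4))
    then have "N \<in> g.Y" using ext_cspace[OF x] by (auto simp: g.Y_def)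
    then have "N \<in> g.X" using g.Y_X by blast
    moreover have "N c = ext s c" if "c \<in> edge_pairs G" for c
      using edges_induced[OF that] M(2) by (auto simp: M(4) ext_def)
    moreover have "det_on ?V (sym_mat N) \<noteq> 0"
      using mat_inverses_det[OF g.finite_verts inv] by auto
    moreover have "a' M = a' s" by (rule polyfun_cong[OF a'(1) M(2)])
    then have "g.jac N \<noteq> 0" using a'(3)[OF M(1)] z(2) by (auto simp: s_def M(4))
    ultimately show ?thesis by (simp add: g.fibre_def)
  qed
  have "finite F" "F \<subseteq> g.fibre (ext s)" "\<forall>N\<in>F. det_on ?V (sym_mat N) \<noteq> 0 \<and> g.jac N \<noteq> 0"
    using F_good fibre_s(1) by (auto simp: F_def)
  then obtain \<delta> where \<delta>: "\<delta> > 0"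
    "\<And>t. (\<And>c. c \<in> edge_pairs G \<Longrightarrow> dist (t c) (ext s c) < \<delta>) \<Longrightarrow> finite (g.fibre t) \<Longrightarrow> card F \<le> card (g.fibre t)"
    by (rule g.card_fibre_ge) blast
  obtain t0 where t0: "aG t0 \<noteq> 0" using aG(2) by blast
  obtain w where w: "aG (line (ext s) t0 w) \<noteq> 0"
    "\<And>c. c \<in> edge_pairs G \<Longrightarrow> dist (line (ext s) t0 w c) (ext s c) < \<delta>"
  \<comment> \<open>The point \<open>ext s\<close> may be a zero of \<open>aG\<close>, so the
    condition at the near end of the line is trivial and genericity comes from the far end
    \<open>t0\<close>.\<close>
  proof (rule polyfun_nonzero_near[where x = "ext s" and y = t0 and p = "\<lambda>_. 1"])
    show "(\<lambda>_. 1) \<in> polyfun {}" by (rule polyfun.const)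
    show "aG \<in> polyfun (edge_pairs G)" "aG t0 \<noteq> 0" by fact+
    show "finite (edge_pairs G)" "\<delta> > 0" by (fact g.finI \<delta>(1))+
  qed simp_all
  have "card F \<le> card (g.fibre (line (ext s) t0 w))"
    using aG(3)[OF w(1)] by (intro \<delta>(2) w(2)) auto
  then show ?thesis
    using aG(3)[OF w(1)] \<open>card F = ml_degree H\<close> by simp
qed

end
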